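(* Let $k$, $(K_i)_{i\ge 1}$ and $K=\bigcup_{i\ge1}K_i$ be the fields constructed in the context. Then, up to finite extension, the $K_i/k$ ($i\ge 1$) are the only proper subextensions of unbounded exponent of $K/k$; that is, for every intermediate field $L$ with $k\subseteq L\subsetneq K$ such that $L/k$ has unbounded exponent, there exists an integer $i\ge 1$ such that $K_i\subseteq L$ and $L/K_i$ is finite.
   Context: Let $Q$ be a perfect field of characteristic $p>0$, let $X$ and $Z_i^j,Y_i^j$ ($i\ge1$, $j\ge2$; here $j$ is an upper index, not an exponent) be a family algebraically independent over $Q$, and let $k=Q(X,(Z_i^j,Y_i^j)_{i\ge1,j\ge2})$ be the field of rational functions. All $p$-power roots are taken in a fixed algebraic closure of $k$, and $Q(X^{p^{-\infty}})=\bigcup_{n\ge1}Q(X^{p^{-n}})$. Let $(a_n)_{n\ge1}$ be a family of elements of $Q(X^{p^{-\infty}})$ such that $Q(a_n)=Q(X^{p^{-n}})$ for all $n\ge1$. Put $\theta_i^1=a_i$ for $i\ge1$ and $K_1=\bigcup_{i\ge1}k(\theta_i^1)$. For $n\ge2$ define recursively (upper indices of $\theta$ are indices) $$\theta_1^n=(Z_1^n)^{p^{-1}}\theta_2^{n-1}+(Y_1^n)^{p^{-1}},\qquad \theta_i^n=(Z_i^n)^{p^{-1}}\theta_{2i}^{n-1}+(\theta_{i-1}^n)^{p^{-1}}+(Y_i^n)^{p^{-1}}\quad(i\ge2),$$ and $K_n=\bigcup_{i\ge1}K_{n-1}(\theta_i^n)$ (an increasing union of fields). Finally $K=\bigcup_{n\ge1}K_n$.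 A purely inseparable extension $L/k$ has bounded exponent if $L^{p^e}\subseteq k$ for some $e\in\mathbb N$, and unbounded exponent otherwise. *)

theory Defs
  imports "HOL-Algebra.Algebraic_Closure_Type" "HOL-Algebra.Generated_Fields" "HOL-Library.Poly_Mapping"
begin

text \<open>
  All fields are subfields of one ambient field, the type \<open>'a\<close> (in the theorem, an
  algebraic closure of \<open>k\<close>). \<open>ring_of_type_algebra\<close> is the \<open>HOL-Algebra\<close> structure of that
  type, so the library's notions \<open>subfield\<close>, \<open>generate_field\<close>, \<open>algebraic_closure\<close> and
  \<open>finite_dimension\<close> apply.
\<close>

abbreviation amb :: "'a :: field ring"
  where "amb \<equiv> ring_of_type_algebra"

abbreviation adjoin :: "'a :: field set \<Rightarrow> 'a set \<Rightarrow> 'a set"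
  where "adjoin F S \<equiv> generate_field amb (F \<union> S)"

text \<open>Perfectness of a field of characteristic \<open>p > 0\<close>: the Frobenius map is onto.\<close>

definition perfect_char :: "nat \<Rightarrow> 'a :: field set \<Rightarrow> bool"
  where "perfect_char p F \<longleftrightarrow> (\<forall>x\<in>F. \<exists>y\<in>F. y ^ p = x)"

text \<open>
  A polynomial in the variables \<open>'v\<close> is a finitely supported function from monomials
  (exponent vectors, of type \<open>'v \<Rightarrow>\<^sub>0 nat\<close>) to coefficients.
\<close>

definition eval_mpoly :: "('v \<Rightarrow> 'a) \<Rightarrow> (('v \<Rightarrow>\<^sub>0 nat) \<Rightarrow>\<^sub>0 'a) \<Rightarrow> 'a :: field"
  where "eval_mpoly f P =
    (\<Sum>m\<in>Poly_Mapping.keys P. Poly_Mapping.lookup P m *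
       (\<Prod>v\<in>Poly_Mapping.keys m. f v ^ Poly_Mapping.lookup m v))"

definition alg_independent :: "'a :: field set \<Rightarrow> 'v set \<Rightarrow> ('v \<Rightarrow> 'a) \<Rightarrow> bool"
  where "alg_independent F I f \<longleftrightarrow>
    (\<forall>P :: ('v \<Rightarrow>\<^sub>0 nat) \<Rightarrow>\<^sub>0 'a.
       (\<forall>m. Poly_Mapping.lookup P m \<in> F) \<longrightarrow>
       (\<forall>m\<in>Poly_Mapping.keys P. Poly_Mapping.keys m \<subseteq> I) \<longrightarrow>
       eval_mpoly f P = 0 \<longrightarrow> P = 0)"

datatype indet = IndX | IndZ nat nat | IndY nat nat

definition indets :: "indet set"
  where "indets = {IndX} \<union> {IndZ i j | i j. i \<ge> 1 \<and> j \<ge> 2} \<union> {IndY i j | i j. i \<ge> 1 \<and> j \<ge> 2}"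

text \<open>\<open>Z i j\<close> and \<open>Y i j\<close> stand for $Z_i^j$ and $Y_i^j$. The indeterminate $X$ is written
  \<open>x\<close>, since \<open>X\<close> is \<open>HOL-Algebra\<close> syntax for the polynomial variable.\<close>

fun indet_val :: "'a \<Rightarrow> (nat \<Rightarrow> nat \<Rightarrow> 'a) \<Rightarrow> (nat \<Rightarrow> nat \<Rightarrow> 'a) \<Rightarrow> indet \<Rightarrow> 'a" where
  "indet_val x Z Y IndX = x"
| "indet_val x Z Y (IndZ i j) = Z i j"
| "indet_val x Z Y (IndY i j) = Y i j"

definition base_field ::
    "'a :: field set \<Rightarrow> 'a \<Rightarrow> (nat \<Rightarrow> nat \<Rightarrow> 'a) \<Rightarrow> (nat \<Rightarrow> nat \<Rightarrow> 'a) \<Rightarrow> 'a set"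
  where "base_field Q x Z Y = adjoin Q (indet_val x Z Y ` indets)"

text \<open>
  The root $x^{p^{-n}}$; it exists and is unique when the ambient field is algebraically
  closed of characteristic \<open>p\<close>.
\<close>

definition proot :: "nat \<Rightarrow> nat \<Rightarrow> 'a :: field \<Rightarrow> 'a"
  where "proot p n x = (THE y. y ^ (p ^ n) = x)"

text \<open>
  \<open>theta p a Z Y n i\<close> is $\theta_i^n$, for \<open>n \<ge> 1\<close> and \<open>i \<ge> 1\<close>; the values
  at \<open>n = 0\<close> or \<open>i = 0\<close> are irrelevant. The lemmas below restate the recursion
  without successors.
\<close>

fun theta :: "nat \<Rightarrow> (nat \<Rightarrow> 'a :: field) \<Rightarrow> (nat \<Rightarrow> nat \<Rightarrow> 'a) \<Rightarrow> (nat \<Rightarrow> nat \<Rightarrow> 'a) \<Rightarrow>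
    nat \<Rightarrow> nat \<Rightarrow> 'a" where
  "theta p a Z Y 0 i = 0"
| "theta p a Z Y (Suc 0) i = a i"
| "theta p a Z Y (Suc (Suc m)) 0 = 0"
| "theta p a Z Y (Suc (Suc m)) (Suc 0) =
     proot p 1 (Z 1 (Suc (Suc m))) * theta p a Z Y (Suc m) 2
     + proot p 1 (Y 1 (Suc (Suc m)))"
| "theta p a Z Y (Suc (Suc m)) (Suc (Suc l)) =
     proot p 1 (Z (Suc (Suc l)) (Suc (Suc m))) * theta p a Z Y (Suc m) (2 * Suc (Suc l))
     + proot p 1 (theta p a Z Y (Suc (Suc m)) (Suc l))
     + proot p 1 (Y (Suc (Suc l)) (Suc (Suc m)))"

lemma theta_level_one: "theta p a Z Y 1 i = a i"
  by simp

lemma theta_index_one: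
  assumes "n \<ge> 2"
  shows "theta p a Z Y n 1 = proot p 1 (Z 1 n) * theta p a Z Y (n - 1) 2 + proot p 1 (Y 1 n)"
proof -
  obtain m where "n = Suc (Suc m)"
    using assms by (cases n rule: nat.exhaust; cases "n - 1" rule: nat.exhaust) auto
  then show ?thesis by simp
qed

lemma theta_index_step:
  assumes "n \<ge> 2" "i \<ge> 2"
  shows "theta p a Z Y n i = proot p 1 (Z i n) * theta p a Z Y (n - 1) (2 * i)
           + proot p 1 (theta p a Z Y n (i - 1)) + proot p 1 (Y i n)"
proof -
  obtain m where "n = Suc (Suc m)"
    using assms by (cases n rule: nat.exhaust; cases "n - 1" rule: nat.exhaust) auto
  moreover obtain l where "i = Suc (Suc l)"
    using assms by (cases i rule: nat.exhaust; cases "i - 1" rule: nat.exhaust) auto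
  ultimately show ?thesis by simp
qed

text \<open>With the convention $K_0 = k$, the definition of $K_1$ is the general step.\<close>

fun tower :: "'a set \<Rightarrow> nat \<Rightarrow> (nat \<Rightarrow> 'a :: field) \<Rightarrow> (nat \<Rightarrow> nat \<Rightarrow> 'a) \<Rightarrow>
    (nat \<Rightarrow> nat \<Rightarrow> 'a) \<Rightarrow> nat \<Rightarrow> 'a set" where
  "tower k p a Z Y 0 = k"
| "tower k p a Z Y (Suc n) = (\<Union>i\<in>{1..}. adjoin (tower k p a Z Y n) {theta p a Z Y (Suc n) i})"

definition tower_union :: "'a set \<Rightarrow> nat \<Rightarrow> (nat \<Rightarrow> 'a :: field) \<Rightarrow> (nat \<Rightarrow> nat \<Rightarrow> 'a) \<Rightarrow>
    (nat \<Rightarrow> nat \<Rightarrow> 'a) \<Rightarrow> 'a set"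
  where "tower_union k p a Z Y = (\<Union>n\<in>{1..}. tower k p a Z Y n)"

definition bounded_exponent :: "nat \<Rightarrow> 'a :: field set \<Rightarrow> 'a set \<Rightarrow> bool"
  where "bounded_exponent p k L \<longleftrightarrow> (\<exists>e. \<forall>x\<in>L. x ^ (p ^ e) \<in> k)"

end

theory Submission
  imports Defs
begin

text \<open>
  Write \<open>K\<^sub>0 = k, K\<^sub>1, K\<^sub>2, \<dots>\<close> for the tower and \<open>\<theta>(n, i)\<close> for its generators.  Each step has a rigid
  shape: \<open>K\<^sub>n\<^sub>+\<^sub>1\<close> is the increasing union of the simple purely inseparable extensions
  \<open>K\<^sub>n(\<theta>(n + 1, s))\<close>, and \<open>\<theta>(n + 1, s)\<close> has exponent exactly \<open>s\<close> over \<open>K\<^sub>n\<close> (\<open>th_exponent\<close>).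
  In a simple purely inseparable extension an element belongs to the field generated by any
  element of at least the same exponent (\<open>simple_ext_exponent_order\<close>); so a field between \<open>K\<^sub>n\<close>
  and \<open>K\<^sub>n\<^sub>+\<^sub>1\<close> is \<open>K\<^sub>n\<^sub>+\<^sub>1\<close> or one of the \<open>K\<^sub>n(\<theta>(n + 1, s))\<close>.

  The levels are tied together by \<open>exponent_descent\<close>: for \<open>s \<le> j\<close>, an element \<open>w\<close> of \<open>K\<close> with
  \<open>w ^ (p ^ (j + 1))\<close> in \<open>K\<^sub>n(\<theta>(n + 1, s))\<close> satisfies \<open>w ^ (p ^ j) \<in> K\<^sub>n\<^sub>+\<^sub>1\<close>.  To see this, expand
  \<open>w\<close> in powers of some \<open>\<theta>(N + 1, f)\<close>, \<open>N > n\<close>, with coefficients in \<open>K\<^sub>N(\<theta>(N + 1, f - 1))\<close>.  With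
  \<open>q = p ^ (j + 1)\<close> and \<open>P = p ^ j\<close>, the recursion gives
  \<open>\<theta>(N + 1, f) ^ q = Z ^ P * \<theta>(N, 2 * f) ^ q + Y ^ P + \<dots>\<close>, where \<open>Z\<close> and \<open>Y\<close> are the two
  indeterminates of index \<open>(f, N + 1)\<close>; everything else in the expansion of \<open>w ^ q\<close> involves
  these two only through \<open>Z ^ q\<close> and \<open>Y ^ q\<close>.  Comparing coefficients of powers of \<open>Y ^ P\<close> and
  \<open>Z ^ P\<close> forces \<open>\<theta>(N, 2 * f) ^ q\<close> into \<open>K\<^sub>n(\<theta>(n + 1, s))\<close> (\<open>descent_from_power\<close>).  This is
  where the doubled index enters: the exponent of \<open>\<theta>(N, 2 * f)\<close> over \<open>K\<^sub>n\<close> is twice the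
  exponent of \<open>\<theta>(N + 1, f)\<close> over \<open>K\<^sub>n\<^sub>+\<^sub>1\<close> (\<open>th_exponent_below\<close>), so the latter is at most
  \<open>(j + 1 + s) div 2 \<le> j\<close>, and the leading term can be split off.

  Now let \<open>L\<close> lie between \<open>k\<close> and \<open>K\<close>, properly, and let \<open>n\<close> be such that \<open>K\<^sub>n\<close>, but not
  \<open>K\<^sub>n\<^sub>+\<^sub>1\<close>, is contained in \<open>L\<close>.  Then \<open>L \<inter> K\<^sub>n\<^sub>+\<^sub>1\<close> is one of the \<open>K\<^sub>n(\<theta>(n + 1, s))\<close>, and the descent
  bounds the exponent of \<open>L\<close> over \<open>K\<^sub>n\<^sub>+\<^sub>1\<close> by \<open>s\<close>, hence over \<open>K\<^sub>n\<close> by \<open>2 * s\<close>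
  (\<open>bounded_if_next_level_missing\<close>).  In particular \<open>n \<noteq> 0\<close> when \<open>L\<close> has unbounded exponent over
  \<open>k\<close>.  The case \<open>s = j = 0\<close> of the descent confines \<open>L\<close> to some \<open>K\<^sub>n\<^sub>+\<^sub>e\<close> (\<open>bounded_level\<close>), and the
  part of \<open>K\<^sub>n\<^sub>+\<^sub>e\<close> of exponent at most \<open>e\<close> over \<open>K\<^sub>n\<close> lies in a finite extension of \<open>K\<^sub>n\<close>
  (\<open>bounded_part_finite\<close>).
\<close>

section \<open>Subfields of the ambient field\<close>

lemma amb_simps [simp]:
  "carrier (amb :: 'a :: field ring) = UNIV" "\<one>\<^bsub>(amb :: 'a ring)\<^esub> = 1" "\<zero>\<^bsub>(amb :: 'a ring)\<^esub> = 0"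
  "x \<oplus>\<^bsub>(amb :: 'a ring)\<^esub> y = x + y" "x \<otimes>\<^bsub>(amb :: 'a ring)\<^esub> y = x * y"
  by (simp_all add: ring_of_type_algebra_def)

lemma amb_field: "field (amb :: 'a :: field ring)"
  by (rule field_from_type_algebra)

lemma amb_uminus [simp]: "\<ominus>\<^bsub>(amb :: 'a :: field ring)\<^esub> x = - x"
proof -
  interpret field "amb :: 'a ring" by (rule amb_field)
  show ?thesis
    using minus_equality[of "- x" x] by simp
qed

lemma amb_inv [simp]:
  assumes "x \<noteq> 0"
  shows "inv\<^bsub>(amb :: 'a :: field ring)\<^esub> x = inverse x"
proof -
  interpret field "amb :: 'a ring" by (rule amb_field)
  show ?thesis
    using inv_char[of x "inverse x"] assms by simp
qed

lemma subfield_ambI: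
  fixes F :: "'a :: field set"
  assumes "1 \<in> F" "\<And>x y. x \<in> F \<Longrightarrow> y \<in> F \<Longrightarrow> x + y \<in> F" "\<And>x. x \<in> F \<Longrightarrow> - x \<in> F"
    "\<And>x y. x \<in> F \<Longrightarrow> y \<in> F \<Longrightarrow> x * y \<in> F" "\<And>x. x \<in> F \<Longrightarrow> x \<noteq> 0 \<Longrightarrow> inverse x \<in> F"
  shows "subfield F amb"
proof -
  interpret field "amb :: 'a ring" by (rule amb_field)
  show ?thesis
    by (rule subfieldI'[OF subringI]) (use assms in auto)
qed

context
  fixes F :: "'a :: field set"
  assumes F: "subfield F amb"
begin

lemma sf_one: "1 \<in> F" and sf_zero: "0 \<in> F"
  and sf_add: "x \<in> F \<Longrightarrow> y \<in> F \<Longrightarrow> x + y \<in> F"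
  and sf_mult: "x \<in> F \<Longrightarrow> y \<in> F \<Longrightarrow> x * y \<in> F"
  and sf_uminus: "x \<in> F \<Longrightarrow> - x \<in> F"
  and sf_inverse: "x \<in> F \<Longrightarrow> inverse x \<in> F"
proof -
  interpret field "amb :: 'a ring" by (rule amb_field)
  have r: "subring F amb" using F by (rule subfieldE)
  show "1 \<in> F" "0 \<in> F" using subringE(2,3)[OF r] by auto
  show "x \<in> F \<Longrightarrow> y \<in> F \<Longrightarrow> x + y \<in> F" "x \<in> F \<Longrightarrow> y \<in> F \<Longrightarrow> x * y \<in> F" "x \<in> F \<Longrightarrow> - x \<in> F"
    using subringE(5-7)[OF r] by auto
  show "x \<in> F \<Longrightarrow> inverse x \<in> F"
    using subfield_m_inv(1)[OF F, of x] \<open>0 \<in> F\<close> by (cases "x = 0") auto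
qed

lemma sf_diff: "x \<in> F \<Longrightarrow> y \<in> F \<Longrightarrow> x - y \<in> F"
  using sf_add[of x "- y"] sf_uminus[of y] by simp

lemma sf_divide: "x \<in> F \<Longrightarrow> y \<in> F \<Longrightarrow> x / y \<in> F"
  using sf_mult[of x "inverse y"] sf_inverse[of y] by (simp add: divide_inverse)

lemma sf_power: "x \<in> F \<Longrightarrow> x ^ n \<in> F"
  by (induction n) (auto simp: sf_one sf_mult)

lemma sf_sum: "(\<And>i. i \<in> A \<Longrightarrow> g i \<in> F) \<Longrightarrow> sum g A \<in> F"
  by (induction A rule: infinite_finite_induct) (auto simp: sf_zero sf_add)

lemma sf_of_nat: "of_nat n \<in> F"
  by (induction n) (auto simp: sf_zero sf_one sf_add)

lemma sf_mult_cancel: "x * y \<in> F \<Longrightarrow> x \<in> F \<Longrightarrow> x \<noteq> 0 \<Longrightarrow> y \<in> F"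
  using sf_divide[of "x * y" x] by simp

lemma sf_add_cancel: "x + y \<in> F \<Longrightarrow> x \<in> F \<Longrightarrow> y \<in> F"
  using sf_diff[of "x + y" x] by simp

lemma sf_poly: "(\<And>i. coeff g i \<in> F) \<Longrightarrow> z \<in> F \<Longrightarrow> poly g z \<in> F"
  by (auto simp: poly_altdef intro!: sf_sum sf_mult sf_power)

end

lemmas sf_closed = sf_one sf_zero sf_add sf_mult sf_uminus sf_inverse sf_diff sf_divide sf_power
  sf_sum sf_of_nat

abbreviation fld :: "'a :: field set \<Rightarrow> 'a set" where "fld S \<equiv> generate_field amb S"

lemma fld_subfield: "subfield (fld S) (amb :: 'a :: field ring)"
  by (rule field.generate_field_is_subfield[OF amb_field]) simp

lemma fld_incl: "x \<in> S \<Longrightarrow> x \<in> fld S"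
  by (rule generate_field.incl)

lemma fld_least: "subfield F amb \<Longrightarrow> S \<subseteq> F \<Longrightarrow> fld S \<subseteq> (F :: 'a :: field set)"
  by (rule field.generate_field_min_subfield1[OF amb_field]) simp_all

lemma fld_mono: "S \<subseteq> T \<Longrightarrow> fld S \<subseteq> (fld T :: 'a :: field set)"
  by (rule field.mono_generate_field[OF amb_field]) simp_all

lemma fld_subset_fld: "S \<subseteq> fld T \<Longrightarrow> fld S \<subseteq> (fld T :: 'a :: field set)"
  by (rule fld_least[OF fld_subfield])

lemma fld_eqI: "S \<subseteq> fld T \<Longrightarrow> T \<subseteq> fld S \<Longrightarrow> fld S = (fld T :: 'a :: field set)"
  by (simp add: fld_subset_fld subset_antisym)

lemma fld_id: "subfield F amb \<Longrightarrow> fld F = (F :: 'a :: field set)"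
  using fld_least[of F F] fld_incl[of _ F] by blast

lemma fld_Un_fld: "fld (fld S \<union> T) = (fld (S \<union> T) :: 'a :: field set)"
proof (rule fld_eqI)
  show "fld S \<union> T \<subseteq> fld (S \<union> T)"
    using fld_mono[of S "S \<union> T"] by (auto intro: fld_incl)
  show "S \<union> T \<subseteq> fld (fld S \<union> T)"
    using fld_incl[of _ S] fld_incl[of _ "fld S \<union> T"] by blast
qed

lemma adjoin_least:
  assumes "subfield E amb" "F \<subseteq> E" "S \<subseteq> E"
  shows "adjoin F S \<subseteq> (E :: 'a :: field set)"
  using fld_least[OF assms(1), of "F \<union> S"] assms by blast

lemma adjoin_absorb:
  assumes "subfield F amb" "S \<subseteq> (F :: 'a :: field set)"
  shows "adjoin F S = F"
  using fld_id[OF assms(1)] assms(2) by (simp add: Un_absorb2)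

lemma subfield_UN_chain:
  fixes F :: "nat \<Rightarrow> 'a :: field set"
  assumes sub: "\<And>i. i \<in> I \<Longrightarrow> subfield (F i) amb" and "I \<noteq> {}"
    and chain: "\<And>i j. i \<in> I \<Longrightarrow> j \<in> I \<Longrightarrow> i \<le> j \<Longrightarrow> F i \<subseteq> F j"
  shows "subfield (\<Union>i\<in>I. F i) amb"
proof (rule subfield_ambI)
  have common: "\<exists>i\<in>I. x \<in> F i \<and> y \<in> F i" if "x \<in> (\<Union>i\<in>I. F i)" "y \<in> (\<Union>i\<in>I. F i)" for x y
    using that chain by (metis UN_E nat_le_linear subsetD)
  show "1 \<in> (\<Union>i\<in>I. F i)" using \<open>I \<noteq> {}\<close> sf_one[OF sub] by blast
  fix x assume x: "x \<in> (\<Union>i\<in>I. F i)"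
  show "- x \<in> (\<Union>i\<in>I. F i)" using x sf_uminus[OF sub] by blast
  show "inverse x \<in> (\<Union>i\<in>I. F i)" using x sf_inverse[OF sub] by blast
  fix y assume y: "y \<in> (\<Union>i\<in>I. F i)"
  show "x + y \<in> (\<Union>i\<in>I. F i)" using common[OF x y] sf_add[OF sub] by blast
  show "x * y \<in> (\<Union>i\<in>I. F i)" using common[OF x y] sf_mult[OF sub] by blast
qed

section \<open>Frobenius in positive characteristic\<close>

locale char_p =
  fixes p :: nat and ty :: "'a :: field itself"
  assumes char: "CHAR('a) = p" and p_pos: "p > 0"
begin

lemma prime_p: "prime p"
  using prime_CHAR_semidom[where 'a = 'a] char p_pos by auto

lemma p_ge2: "p \<ge> 2"
  using prime_p by (rule prime_ge_2_nat)

lemma frob_add: "(x + y :: 'a) ^ (p ^ m) = x ^ (p ^ m) + y ^ (p ^ m)"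
  using freshmans_dream'[where ?'a = 'a, of "p ^ m" m x y] prime_p char by simp

lemma frob_uminus: "(- x :: 'a) ^ (p ^ m) = - (x ^ (p ^ m))"
proof -
  have "x ^ (p ^ m) + (- x) ^ (p ^ m) = 0"
    using frob_add[of x "- x" m] p_pos by (simp add: power_0_left)
  then show ?thesis by (simp add: add_eq_0_iff)
qed

lemma frob_diff: "(x - y :: 'a) ^ (p ^ m) = x ^ (p ^ m) - y ^ (p ^ m)"
  using frob_add[of x "- y" m] frob_uminus[of y m] by simp

lemma frob_sum: "(sum g A :: 'a) ^ (p ^ m) = (\<Sum>i\<in>A. g i ^ (p ^ m))"
  by (induction A rule: infinite_finite_induct) (auto simp: frob_add p_pos power_0_left)

lemma frob_inj: "(x :: 'a) ^ (p ^ m) = y ^ (p ^ m) \<Longrightarrow> x = y"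
  using frob_diff[of x y m] by simp

lemma frob_preimage_subfield:
  assumes "subfield F (amb :: 'a ring)"
  shows "subfield {x. x ^ (p ^ m) \<in> F} amb"
  by (rule subfield_ambI)
     (use sf_closed[OF assms] in \<open>auto simp: frob_add frob_uminus power_mult_distrib power_inverse\<close>)

lemma frob_fld:
  assumes "\<And>s. s \<in> S \<Longrightarrow> s ^ (p ^ m) \<in> F" "subfield F (amb :: 'a ring)" "x \<in> fld S"
  shows "x ^ (p ^ m) \<in> F"
  using fld_least[OF frob_preimage_subfield[OF assms(2)], of S m] assms by blast

lemma frob_mono:
  assumes "subfield F (amb :: 'a ring)" "x ^ (p ^ m) \<in> F" "m \<le> m'"
  shows "x ^ (p ^ m') \<in> F"
proof -
  have "p ^ m' = p ^ m * p ^ (m' - m)" using assms(3) by (simp flip: power_add)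
  then show ?thesis using sf_power[OF assms(1,2), of "p ^ (m' - m)"] by (simp add: power_mult)
qed

lemma frob_Suc: "(x :: 'a) ^ (p ^ Suc m) = (x ^ p) ^ (p ^ m)"
  by (simp add: power_mult)

end

section \<open>Polynomials with coefficients in a subfield\<close>

abbreviation poly_over :: "'a :: field set \<Rightarrow> 'a poly \<Rightarrow> bool"
  where "poly_over F g \<equiv> (\<forall>i. coeff g i \<in> F)"

context
  fixes F :: "'a :: field set"
  assumes F: "subfield F amb"
begin

lemma poly_over_add: "poly_over F g \<Longrightarrow> poly_over F h \<Longrightarrow> poly_over F (g + h)"
  by (simp add: sf_add[OF F])

lemma poly_over_diff: "poly_over F g \<Longrightarrow> poly_over F h \<Longrightarrow> poly_over F (g - h)"
  by (simp add: sf_diff[OF F])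

lemma poly_over_mult: "poly_over F g \<Longrightarrow> poly_over F h \<Longrightarrow> poly_over F (g * h)"
  by (auto simp: coeff_mult intro!: sf_sum[OF F] sf_mult[OF F])

lemma poly_over_monom: "c \<in> F \<Longrightarrow> poly_over F (monom c n)"
  by (simp add: sf_zero[OF F])

lemma poly_over_const: "c \<in> F \<Longrightarrow> poly_over F [:c:]"
  by (auto simp: coeff_pCons sf_zero[OF F] split: nat.split)

lemma poly_over_division:
  assumes f: "poly_over F f" "f \<noteq> 0" and g: "poly_over F g"
  shows "\<exists>q r. poly_over F q \<and> poly_over F r \<and> g = q * f + r \<and> (r = 0 \<or> degree r < degree f)"
  using g
proof (induction "degree g" arbitrary: g rule: less_induct)
  case less
  show ?case
  proof (cases "g = 0 \<or> degree g < degree f")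
    case True
    with less.prems sf_zero[OF F] show ?thesis
      by (intro exI[of _ 0] exI[of _ g]) auto
  next
    case False
    define m where "m = monom (lead_coeff g / lead_coeff f) (degree g - degree f)"
    have m: "poly_over F m"
      unfolding m_def using f(1) less.prems by (intro poly_over_monom sf_divide[OF F]) auto
    have "degree (g - m * f) \<le> degree g"
    proof (rule degree_diff_le)
      have "degree (m * f) \<le> degree m + degree f" by (rule degree_mult_le)
      also have "degree m \<le> degree g - degree f" unfolding m_def by (rule degree_monom_le)
      finally show "degree (m * f) \<le> degree g" using False by simp
    qed simp
    moreover have "coeff (g - m * f) (degree g) = 0"
      using False f(2) by (simp add: m_def coeff_monom_mult)
    ultimately have "g - m * f = 0 \<or> degree (g - m * f) < degree g"
      by (rule eq_zero_or_degree_less)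
    then show ?thesis
    proof
      assume "g - m * f = 0"
      with m sf_zero[OF F] show ?thesis by (intro exI[of _ m] exI[of _ 0]) auto
    next
      assume "degree (g - m * f) < degree g"
      moreover have "poly_over F (g - m * f)"
        using less.prems m f(1) by (intro poly_over_diff poly_over_mult)
      ultimately obtain q r where qr: "poly_over F q" "poly_over F r" "g - m * f = q * f + r"
          "r = 0 \<or> degree r < degree f"
        using less.hyps by blast
      show ?thesis
      proof (intro exI conjI)
        show "poly_over F (q + m)" using qr(1) m by (rule poly_over_add)
        show "g = (q + m) * f + r" using qr(3) by (simp add: algebra_simps)
      qed (use qr in auto)
    qed
  qed
qed

end

lemma divisor_of_linear_power_degree:
  fixes z :: "'a :: field"
  assumes "h * g = [:- z, 1:] ^ n" "poly h z \<noteq> 0"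
  shows "degree h = 0"
  using assms(1)
proof (induction n arbitrary: g)
  case 0
  then have "h dvd 1" by (metis dvdI power_0)
  then show ?case by (simp add: is_unit_poly_iff) (metis degree_pCons_0)
next
  case (Suc n)
  have "poly (h * g) z = 0" by (simp only: Suc.prems) simp
  then have "poly h z * poly g z = 0" by simp
  with assms(2) obtain g' where g': "g = [:- z, 1:] * g'"
    by (auto simp: poly_eq_0_iff_dvd elim: dvdE)
  with Suc.prems have "[:- z, 1:] * (h * g') = [:- z, 1:] * [:- z, 1:] ^ n"
    by (simp add: algebra_simps)
  then have "h * g' = [:- z, 1:] ^ n"
    by (subst (asm) mult_cancel_left) auto
  then show ?case by (rule Suc.IH)
qed

lemma coeff_pcompose_monom_mult:
  assumes "n > 0"
  shows "coeff (pcompose b (monom (1 :: 'a :: comm_ring_1) n)) (n * i) = coeff b i"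
proof (induction b arbitrary: i)
  case (pCons a b)
  then show ?case
    using assms by (cases i) (auto simp: pcompose_pCons coeff_monom_mult coeff_pCons split: nat.split)
qed simp

section \<open>Simple purely inseparable extensions\<close>

context char_p
begin

lemma linear_frob: "[:- z, 1 :: 'a:] ^ (p ^ m) = monom 1 (p ^ m) - [:z ^ (p ^ m):]"
proof -
  have *: "(monom 1 1 + [:- z:] :: 'a poly) ^ (p ^ m) = monom 1 1 ^ (p ^ m) + [:- z:] ^ (p ^ m)"
    using freshmans_dream'[where ?'a = "'a poly"] prime_p char by simp
  have "[:- z, 1:] = monom 1 1 + [:- z:]" by (simp add: monom_altdef)
  with * show ?thesis
    by (simp add: monom_power poly_const_pow frob_uminus)
qed

text \<open>A polynomial of minimal degree over \<open>F\<close> killing \<open>z\<close> divides \<open>X ^ q - z ^ q = (X - z) ^ q\<close>,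
  where \<open>q = p ^ (j + 1)\<close>, so it is \<open>c * (X - z) ^ d\<close>.  Its constant coefficient shows
  \<open>z ^ d \<in> F\<close>, and Bezout improves this to \<open>z ^ gcd d q \<in> F\<close>, where the gcd divides \<open>p ^ j\<close>
  if \<open>0 < d < q\<close>.\<close>

lemma no_small_relation:
  assumes F: "subfield F (amb :: 'a ring)" and zq: "z ^ (p ^ Suc j) \<in> F" and z: "z ^ (p ^ j) \<notin> F"
    and f: "poly_over F f" "degree f < p ^ Suc j" "poly f z = 0"
  shows "f = 0"
proof (rule ccontr)
  assume "f \<noteq> 0"
  define q where "q = p ^ Suc j"
  define R where "R = (\<lambda>g. poly_over F g \<and> g \<noteq> 0 \<and> poly g z = 0)"
  obtain g where g: "R g" and min: "\<And>h. R h \<Longrightarrow> degree g \<le> degree h"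
    using ex_has_least_nat[of R f degree] f \<open>f \<noteq> 0\<close> by (auto simp: R_def)
  have "degree g < q" using min[of f] f \<open>f \<noteq> 0\<close> by (simp add: R_def q_def)
  have "poly_over F (monom 1 q - [:z ^ q:])"
    using zq by (intro poly_over_diff[OF F] poly_over_monom[OF F] poly_over_const[OF F] sf_one[OF F])
      (simp add: q_def)
  then obtain u r where ur: "poly_over F r" "monom 1 q - [:z ^ q:] = u * g + r"
      "r = 0 \<or> degree r < degree g"
    using poly_over_division[OF F] g unfolding R_def by blast
  have "poly (monom 1 q - [:z ^ q:]) z = 0" by (simp add: poly_monom)
  then have "poly r z = 0" using g by (simp add: ur(2) R_def)
  with min[of r] ur have "r = 0" unfolding R_def by force
  then have dvd: "g * u = [:- z, 1:] ^ q"
    using ur(2) linear_frob[of z "Suc j"] by (simp add: q_def mult.commute)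
  obtain h where h: "g = [:- z, 1:] ^ order z g * h" "\<not> [:- z, 1:] dvd h"
    using order_decomp[of g z] g by (auto simp: R_def)
  define d where "d = order z g"
  have "d \<le> q"
  proof -
    have "d \<le> degree g" using order_degree[of g z] g by (simp add: d_def R_def)
    then show ?thesis using \<open>degree g < q\<close> by simp
  qed
  have "[:- z, 1:] ^ d * (h * u) = [:- z, 1:] ^ d * [:- z, 1:] ^ (q - d)"
    using dvd h(1) \<open>d \<le> q\<close> by (simp add: mult.assoc flip: d_def power_add)
  then have "h * u = [:- z, 1:] ^ (q - d)"
    by (subst (asm) mult_cancel_left) auto
  moreover have "poly h z \<noteq> 0" using h(2) by (simp add: poly_eq_0_iff_dvd)
  ultimately have "degree h = 0" by (rule divisor_of_linear_power_degree)
  then obtain c where c: "h = [:c:]" by (rule degree_eq_zeroE)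
  have "c \<noteq> 0" using g h(1) by (auto simp: R_def c)
  have gc: "g = smult c ([:- z, 1:] ^ d)" using h(1) by (simp add: c d_def)
  have deg: "degree g = d" using \<open>c \<noteq> 0\<close> by (simp add: gc degree_linear_power)
  have "c \<in> F"
  proof -
    have "coeff g d = c" using coeff_linear_power[of "- z" d] by (simp add: gc)
    then show ?thesis using g unfolding R_def by metis
  qed
  have "d > 0"
  proof (rule ccontr)
    assume "\<not> d > 0"
    then show False using g \<open>c \<noteq> 0\<close> by (simp add: R_def gc)
  qed
  have "z ^ d \<in> F"
  proof -
    have "poly g 0 \<in> F" using g by (intro sf_poly[OF F] sf_zero[OF F]) (simp_all add: R_def)
    then have "c * (- z) ^ d \<in> F" by (simp add: gc)
    then have "(- z) ^ d \<in> F" using sf_mult_cancel[OF F] \<open>c \<in> F\<close> \<open>c \<noteq> 0\<close> by blast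
    then show ?thesis
      using sf_uminus[OF F, of "(- z) ^ d"] by (cases "even d") auto
  qed
  obtain a b where ab: "d * a = q * b + gcd d q" using bezout_nat[of d q] \<open>d > 0\<close> by auto
  have "z \<noteq> 0" using z sf_zero[OF F] p_pos by (auto simp: power_0_left)
  have "z ^ gcd d q \<in> F"
  proof -
    have "z ^ (q * b) * z ^ gcd d q = z ^ (d * a)" by (simp add: ab power_add)
    moreover have "z ^ (d * a) \<in> F" "z ^ (q * b) \<in> F"
      using \<open>z ^ d \<in> F\<close> zq sf_power[OF F] by (simp_all add: power_mult q_def)
    ultimately show ?thesis using sf_mult_cancel[OF F] \<open>z \<noteq> 0\<close> by (metis power_not_zero)
  qed
  moreover obtain r where r: "gcd d q = p ^ r"
    using divides_primepow_nat[OF prime_p, of "gcd d q" "Suc j"] by (auto simp: q_def)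
  moreover have "r \<le> j"
  proof -
    have "p ^ r \<le> d" using \<open>d > 0\<close> unfolding r[symmetric] by simp
    then have "p ^ r < p ^ Suc j" using \<open>degree g < q\<close> deg by (simp add: q_def)
    then show ?thesis using power_less_imp_less_exp[of p r "Suc j"] p_ge2 by simp
  qed
  ultimately show False using frob_mono[OF F, of z r j] z by simp
qed

text \<open>The values \<open>poly f z\<close> already form a field: the inverse of \<open>y\<close> is
  \<open>y ^ (q - 1) / y ^ q\<close>, and \<open>y ^ q \<in> F\<close> for \<open>q = p ^ m\<close>.\<close>

lemma adjoin_root_as_poly:
  assumes F: "subfield F (amb :: 'a ring)" and zq: "z ^ (p ^ m) \<in> F" and v: "v \<in> adjoin F {z}"
  obtains f where "poly_over F f" "degree f < p ^ m" "v = poly f z"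
proof -
  define q where "q = p ^ m"
  have "q > 0" using p_pos by (simp add: q_def)
  define R where "R = {poly f z | f. poly_over F f}"
  have R_I: "poly_over F f \<Longrightarrow> poly f z \<in> R" for f by (auto simp: R_def)
  have R_F: "y \<in> R" if "y \<in> F" for y using R_I[OF poly_over_const[OF F that]] by simp
  have mult: "y * w \<in> R" if "y \<in> R" "w \<in> R" for y w
  proof -
    obtain f g where "poly_over F f" "y = poly f z" "poly_over F g" "w = poly g z"
      using \<open>y \<in> R\<close> \<open>w \<in> R\<close> by (auto simp: R_def)
    then show ?thesis using R_I[OF poly_over_mult[OF F, of f g]] by simp
  qed
  have pow: "y ^ n \<in> R" if "y \<in> R" for y n
    by (induction n) (use mult R_F sf_one[OF F] that in auto)
  have frob: "y ^ q \<in> F" if y: "y \<in> R" for y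
  proof -
    obtain f where f: "poly_over F f" "y = poly f z" using y by (auto simp: R_def)
    have "y ^ q = (\<Sum>i\<le>degree f. coeff f i ^ q * (z ^ q) ^ i)"
      by (simp add: f poly_altdef q_def frob_sum power_mult_distrib flip: power_mult)
         (simp add: mult.commute)
    then show ?thesis using f zq
      by (auto simp: q_def intro!: sf_sum[OF F] sf_mult[OF F] sf_power[OF F])
  qed
  have "subfield R amb"
  proof (rule subfield_ambI)
    show "1 \<in> R" by (intro R_F sf_one[OF F])
    fix x assume x: "x \<in> R"
    show "- x \<in> R"
      using mult[OF R_F[OF sf_uminus[OF F sf_one[OF F]]] x] by simp
    show "x + y \<in> R" if y: "y \<in> R" for y
    proof -
      obtain f g where "poly_over F f" "x = poly f z" "poly_over F g" "y = poly g z"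
        using x y by (auto simp: R_def)
      then show ?thesis using R_I[OF poly_over_add[OF F, of f g]] by simp
    qed
    show "x * y \<in> R" if y: "y \<in> R" for y using x y by (rule mult)
    assume "x \<noteq> 0"
    have "inverse x = x ^ (q - 1) * inverse (x ^ q)"
      using \<open>x \<noteq> 0\<close> \<open>q > 0\<close> power_Suc[of x "q - 1"] by (simp add: field_simps)
    then show "inverse x \<in> R"
      using mult[OF pow[OF x] R_F[OF sf_inverse[OF F frob[OF x]]]] by simp
  qed
  moreover have "z \<in> R"
    using R_I[OF poly_over_monom[OF F sf_one[OF F], of 1]] by (simp add: poly_monom)
  ultimately have "adjoin F {z} \<subseteq> R" by (intro adjoin_least) (use R_F in auto)
  then obtain f where f: "poly_over F f" "v = poly f z" using v by (auto simp: R_def)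
  have m: "poly_over F (monom 1 q - [:z ^ q:])"
    using zq by (intro poly_over_diff[OF F] poly_over_monom[OF F] poly_over_const[OF F] sf_one[OF F])
      (simp add: q_def)
  have deg: "degree (monom 1 q - [:z ^ q:]) = q"
    using \<open>q > 0\<close> degree_linear_power[of "- z" q] linear_frob[of z m] by (simp add: q_def)
  then have nz: "monom 1 q - [:z ^ q:] \<noteq> 0" using \<open>q > 0\<close> by (metis degree_0 less_numeral_extra(3))
  obtain u r where ur: "poly_over F r" "f = u * (monom 1 q - [:z ^ q:]) + r" "r = 0 \<or> degree r < q"
    using poly_over_division[OF F m nz f(1)] deg by auto
  have "v = poly r z" by (simp add: f(2) ur(2) poly_monom)
  with ur \<open>q > 0\<close> show ?thesis by (intro that) (auto simp: q_def)
qed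

text \<open>The powers of \<open>z\<close> below \<open>q = p ^ (j + 1)\<close> are linearly independent over the larger field \<open>C\<close>
  by \<open>no_small_relation\<close>, and they span \<open>D(z)\<close> over \<open>D\<close>; so the coordinates over \<open>C\<close> of an
  element of \<open>D(z)\<close> lie in \<open>D\<close>.  The polynomial \<open>b\<close> uses only the powers of \<open>z ^ (p ^ j)\<close>.\<close>

lemma coordinates_descend:
  assumes D: "subfield D (amb :: 'a ring)" and C: "subfield C amb" and "D \<subseteq> C"
    and zq: "z ^ (p ^ Suc j) \<in> D" and z: "z ^ (p ^ j) \<notin> C"
    and b: "poly_over C b" "degree b < p" and v: "poly b (z ^ (p ^ j)) \<in> adjoin D {z}"
  shows "poly_over D b"
proof -
  define g where "g = pcompose b (monom 1 (p ^ j))"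
  have "degree g = degree b * p ^ j" by (simp add: g_def degree_pcompose degree_monom_eq)
  then have deg_g: "degree g < p ^ Suc j" using b(2) p_pos by simp
  have "poly_over C g" unfolding g_def
    by (intro allI coeff_pcompose_semiring_closed)
       (use b sf_closed[OF C] poly_over_monom[OF C] in auto)
  obtain d where d: "poly_over D d" "degree d < p ^ Suc j" "poly b (z ^ (p ^ j)) = poly d z"
    using adjoin_root_as_poly[OF D zq v] .
  have "g - d = 0"
  proof (rule no_small_relation[OF C _ z])
    show "z ^ (p ^ Suc j) \<in> C" using zq \<open>D \<subseteq> C\<close> by blast
    show "poly_over C (g - d)"
      using d(1) \<open>D \<subseteq> C\<close> \<open>poly_over C g\<close> by (intro poly_over_diff[OF C]) auto
    show "degree (g - d) < p ^ Suc j" using deg_g d(2) by (rule degree_diff_less)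
    show "poly (g - d) z = 0" using d(3) by (simp add: g_def poly_pcompose poly_monom)
  qed
  moreover have "coeff g (p ^ j * i) = coeff b i" for i
    unfolding g_def by (rule coeff_pcompose_monom_mult) (simp add: p_pos)
  ultimately show ?thesis using d(1) by (metis right_minus_eq)
qed

text \<open>If \<open>z\<close> were outside \<open>G(v)\<close>, then the expression of \<open>v\<close> as a polynomial of degree below \<open>p\<close> in
  \<open>z\<close> over \<open>G\<close> would be a relation for \<open>z\<close> over \<open>G(v)\<close>, hence trivial, and \<open>v\<close> would be in \<open>G\<close>.\<close>

lemma degree_p_exchange:
  assumes G: "subfield G (amb :: 'a ring)" and zp: "z ^ p \<in> G" and v: "v \<in> adjoin G {z}" "v \<notin> G"
  shows "z \<in> adjoin G {v}"
proof (rule ccontr)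
  assume z: "z \<notin> adjoin G {v}"
  have sub: "subfield (adjoin G {v}) amb" by (rule fld_subfield)
  have GG: "G \<subseteq> adjoin G {v}" "v \<in> adjoin G {v}" by (auto intro: fld_incl)
  obtain f where f: "poly_over G f" "degree f < p" "v = poly f z"
    using adjoin_root_as_poly[OF G, of z 1 v] zp v by auto
  have "f - [:v:] = 0"
  proof (rule no_small_relation[OF sub, of z 0])
    show "poly_over (adjoin G {v}) (f - [:v:])"
      using f(1) GG by (intro poly_over_diff[OF sub] poly_over_const[OF sub]) auto
    have "degree (f - [:v:]) \<le> degree f" by (rule degree_diff_le) simp_all
    then show "degree (f - [:v:]) < p ^ Suc 0" using f(2) by simp
  qed (use zp z f GG in auto)
  then have "v = coeff f 0" by simp
  with f(1) v(2) show False by simp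
qed

lemma exists_frob_jump:
  assumes F: "subfield F (amb :: 'a ring)" and "z ^ (p ^ M) \<in> F" "z ^ (p ^ e) \<notin> F"
  obtains d where "d \<ge> e" "z ^ (p ^ d) \<notin> F" "z ^ (p ^ Suc d) \<in> F"
proof -
  define n where "n = (LEAST n. z ^ (p ^ n) \<in> F)"
  have n: "z ^ (p ^ n) \<in> F" unfolding n_def by (rule LeastI[of _ M]) fact
  have "n > e" using frob_mono[OF F n, of e] assms(3) by (cases "n \<le> e") auto
  then obtain d where d: "n = Suc d" by (cases n) auto
  have "z ^ (p ^ d) \<notin> F" using not_less_Least[of d "\<lambda>n. z ^ (p ^ n) \<in> F"] d by (simp add: n_def)
  then show ?thesis using n d \<open>n > e\<close> by (intro that[of d]) auto
qed

text \<open>The elements of exponent at most one in \<open>F(z)\<close> form an extension of degree \<open>p\<close>, generated by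
  the last power of \<open>z\<close> outside \<open>F\<close>.  The step passes from \<open>z\<close> to \<open>z ^ p\<close>: if \<open>v\<close> were not in
  \<open>F(z ^ p)\<close>, then \<open>z\<close> would be in \<open>F(z ^ p, v)\<close>, so \<open>z ^ p\<close> in \<open>F(z ^ (p ^ 2))\<close>, which lowers
  the exponent of \<open>z\<close>.\<close>

lemma exponent_one_part:
  assumes F: "subfield F (amb :: 'a ring)" and "z ^ (p ^ Suc d) \<in> F" "z ^ (p ^ d) \<notin> F"
    and "v \<in> adjoin F {z}" and vp: "v ^ p \<in> F"
  shows "v \<in> adjoin F {z ^ (p ^ d)}"
  using assms(2-4)
proof (induction d arbitrary: z)
  case 0
  then show ?case by simp
next
  case (Suc d)
  define G where "G = adjoin F {z ^ p}"
  have G: "subfield G amb" unfolding G_def by (rule fld_subfield)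
  have "v \<in> G"
  proof (rule ccontr)
    assume "v \<notin> G"
    have "F \<subseteq> G" "z ^ p \<in> G" unfolding G_def by (auto intro: fld_incl)
    moreover have "v \<in> adjoin G {z}"
      using Suc.prems(3) fld_mono[of "F \<union> {z}" "G \<union> {z}"] \<open>F \<subseteq> G\<close> by blast
    ultimately have z: "z \<in> adjoin G {v}" using degree_p_exchange[OF G] \<open>v \<notin> G\<close> by blast
    define F2 where "F2 = adjoin F {z ^ (p ^ 2)}"
    have F2: "subfield F2 amb" unfolding F2_def by (rule fld_subfield)
    have FF2: "F \<subseteq> F2" "z ^ (p ^ 2) \<in> F2" unfolding F2_def by (auto intro: fld_incl)
    have GF2: "y ^ (p ^ 1) \<in> F2" if "y \<in> G" for y
    proof (rule frob_fld[OF _ F2, where S = "F \<union> {z ^ p}"])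
      show "s ^ (p ^ 1) \<in> F2" if "s \<in> F \<union> {z ^ p}" for s
        using that
      proof
        assume "s \<in> F"
        then show ?thesis using FF2 sf_power[OF F2] by blast
      qed (use FF2 in \<open>simp add: power2_eq_square flip: power_mult\<close>)
    qed (use that in \<open>simp add: G_def\<close>)
    have "z ^ (p ^ 1) \<in> F2"
      by (rule frob_fld[OF _ F2 z]) (use GF2 vp FF2 in auto)
    then have "(z ^ p) ^ (p ^ d) \<in> F"
      unfolding F2_def
      by (intro frob_fld[OF _ F, where x = "z ^ p"])
         (use Suc.prems(1) sf_power[OF F] in \<open>auto simp: power2_eq_square mult.assoc simp flip: power_mult\<close>)
    then show False using Suc.prems(2) by (simp add: power_mult)
  qed
  then have "v \<in> adjoin F {(z ^ p) ^ (p ^ d)}"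
    using Suc.prems(1,2) unfolding G_def by (intro Suc.IH) (simp_all add: power_mult)
  then show ?case by (simp add: power_mult)
qed

text \<open>Exponents decide inclusion inside a simple purely inseparable extension: \<open>y\<close>, of exponent at
  most \<open>e\<close>, lies in \<open>F(x)\<close> as soon as the exponent of \<open>x\<close> is at least \<open>e\<close>.  The induction
  enlarges \<open>F\<close> by \<open>w = x ^ (p ^ r)\<close>, the last power of \<open>x\<close> outside \<open>F\<close>.  This adjoins all
  elements of exponent one in \<open>F(z)\<close>, thus lowers the exponent of \<open>y\<close>, and it lowers that of
  \<open>x\<close> by one only.\<close>

lemma simple_ext_exponent_order:
  assumes F: "subfield F (amb :: 'a ring)" and "z ^ (p ^ M) \<in> F" "x \<in> adjoin F {z}" "y \<in> adjoin F {z}"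
    and "y ^ (p ^ e) \<in> F" "e = 0 \<or> x ^ (p ^ (e - 1)) \<notin> F"
  shows "y \<in> adjoin F {x}"
  using assms
proof (induction e arbitrary: F)
  case 0
  then show ?case by (auto intro: fld_incl)
next
  case (Suc e)
  note F = Suc.prems(1)
  have Fz: "subfield (adjoin F {z}) amb" by (rule fld_subfield)
  have "x ^ (p ^ e) \<notin> F" using Suc.prems by simp
  have "x ^ (p ^ M) \<in> F"
    by (rule frob_fld[OF _ F Suc.prems(3)]) (use Suc.prems(2) sf_power[OF F] in auto)
  then obtain r where r: "r \<ge> e" "x ^ (p ^ r) \<notin> F" "x ^ (p ^ Suc r) \<in> F"
    using exists_frob_jump[OF F] \<open>x ^ (p ^ e) \<notin> F\<close> by blast
  have "z \<notin> F"
  proof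
    assume "z \<in> F"
    then have "x \<in> F" using Suc.prems(3) adjoin_absorb[OF F, of "{z}"] by auto
    then show False using \<open>x ^ (p ^ e) \<notin> F\<close> sf_power[OF F] by blast
  qed
  then obtain d where d: "z ^ (p ^ d) \<notin> F" "z ^ (p ^ Suc d) \<in> F"
    using exists_frob_jump[OF F Suc.prems(2), of 0] by auto
  define w where "w = x ^ (p ^ r)"
  define F' where "F' = adjoin F {w}"
  have F': "subfield F' amb" unfolding F'_def by (rule fld_subfield)
  have FF': "F \<subseteq> F'" "w \<in> F'" unfolding F'_def by (auto intro: fld_incl)
  have wp: "w ^ p \<in> F" using r(3) by (simp add: w_def mult.commute flip: power_mult)
  have w: "w \<in> adjoin F {z ^ (p ^ d)}"
    by (rule exponent_one_part[OF F d(2,1) _ wp]) (use Suc.prems(3) sf_power[OF Fz] in \<open>simp add: w_def\<close>)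
  have z': "z ^ (p ^ d) \<in> F'"
    unfolding F'_def
    by (rule degree_p_exchange[OF F _ w]) (use d r in \<open>simp_all add: w_def mult.commute flip: power_mult\<close>)
  have "y ^ (p ^ e) \<in> adjoin F {z ^ (p ^ d)}"
    by (rule exponent_one_part[OF F d(2,1)])
       (use Suc.prems(4,5) sf_power[OF Fz] in \<open>simp_all add: mult.commute flip: power_mult\<close>)
  also have "\<dots> \<subseteq> F'" by (rule adjoin_least[OF F']) (use FF' z' in auto)
  finally have y: "y ^ (p ^ e) \<in> F'" .
  have F'F: "u ^ (p ^ 1) \<in> F" if "u \<in> F'" for u
    by (rule frob_fld[OF _ F, where S = "F \<union> {w}"]) (use that sf_power[OF F] wp in \<open>auto simp: F'_def\<close>)
  have "y \<in> adjoin F' {x}"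
  proof (rule Suc.IH[OF F' _ _ _ y])
    show "z ^ (p ^ M) \<in> F'" using Suc.prems(2) FF' by blast
    show "x \<in> adjoin F' {z}" "y \<in> adjoin F' {z}"
      using Suc.prems(3,4) fld_mono[of "F \<union> {z}" "F' \<union> {z}"] FF' by auto
    show "e = 0 \<or> x ^ (p ^ (e - 1)) \<notin> F'"
    proof (cases e)
      case (Suc e')
      have "x ^ (p ^ e') \<notin> F'"
      proof
        assume "x ^ (p ^ e') \<in> F'"
        then have "(x ^ (p ^ e')) ^ (p ^ 1) \<in> F" by (rule F'F)
        then show False using \<open>x ^ (p ^ e) \<notin> F\<close> by (simp add: Suc mult.commute flip: power_mult)
      qed
      then show ?thesis by (simp add: Suc)
    qed simp
  qed
  also have "adjoin F' {x} \<subseteq> adjoin F {x}"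
  proof (rule adjoin_least[OF fld_subfield])
    have "x \<in> adjoin F {x}" by (auto intro: fld_incl)
    then have "w \<in> adjoin F {x}" unfolding w_def by (rule sf_power[OF fld_subfield])
    then show "F' \<subseteq> adjoin F {x}"
      unfolding F'_def by (intro adjoin_least[OF fld_subfield]) (auto intro: fld_incl)
  qed (auto intro: fld_incl)
  finally show ?case .
qed

end

section \<open>Monomials in an algebraically independent family\<close>

definition monomial :: "('v \<Rightarrow> 'a) \<Rightarrow> ('v \<Rightarrow>\<^sub>0 nat) \<Rightarrow> 'a :: field"
  where "monomial f m = (\<Prod>v\<in>Poly_Mapping.keys m. f v ^ Poly_Mapping.lookup m v)"

lemma monomial_superset:
  assumes "finite T" "Poly_Mapping.keys m \<subseteq> T"
  shows "monomial f m = (\<Prod>v\<in>T. f v ^ Poly_Mapping.lookup m v)"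
  unfolding monomial_def using assms
  by (intro prod.mono_neutral_left) (auto simp: in_keys_iff)

lemma monomial_add: "monomial f (m + n) = monomial f m * monomial f n"
proof -
  define T where "T = Poly_Mapping.keys m \<union> Poly_Mapping.keys n"
  have "Poly_Mapping.keys (m + n) \<subseteq> T" unfolding T_def by (rule Poly_Mapping.keys_add)
  then show ?thesis
    by (simp add: monomial_superset[of T] T_def lookup_add power_add prod.distrib)
qed

lemma monomial_single: "monomial f (Poly_Mapping.single v n) = f v ^ n"
  by (simp add: monomial_def)

lemma eval_mpoly_superset:
  assumes "finite T" "Poly_Mapping.keys P \<subseteq> T"
  shows "eval_mpoly f P = (\<Sum>m\<in>T. Poly_Mapping.lookup P m * monomial f m)"
  unfolding eval_mpoly_def monomial_def[symmetric] using assms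
  by (intro sum.mono_neutral_left) (auto simp: in_keys_iff)

lemma eval_mpoly_add: "eval_mpoly f (P + R) = eval_mpoly f P + eval_mpoly f R"
proof -
  define T where "T = Poly_Mapping.keys P \<union> Poly_Mapping.keys R"
  have "Poly_Mapping.keys (P + R) \<subseteq> T" unfolding T_def by (rule Poly_Mapping.keys_add)
  then show ?thesis
    by (simp add: eval_mpoly_superset[of T] T_def lookup_add distrib_right sum.distrib)
qed

lemma eval_mpoly_diff: "eval_mpoly f (P - R) = eval_mpoly f P - eval_mpoly f R"
  using eval_mpoly_add[of f "P - R" R] by simp

lemma eval_mpoly_single: "eval_mpoly f (Poly_Mapping.single m c) = c * monomial f m"
  using eval_mpoly_superset[of "{m}" "Poly_Mapping.single m c" f] by simp

inductive_set mono_span :: "'a :: field set \<Rightarrow> ('v \<Rightarrow> 'a) \<Rightarrow> ('v \<Rightarrow>\<^sub>0 nat) set \<Rightarrow> 'a set"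
  for Q f S where
  zero: "0 \<in> mono_span Q f S"
| step: "a \<in> mono_span Q f S \<Longrightarrow> c \<in> Q \<Longrightarrow> m \<in> S \<Longrightarrow> a + c * monomial f m \<in> mono_span Q f S"

lemma mono_span_single: "c \<in> Q \<Longrightarrow> m \<in> S \<Longrightarrow> c * monomial f m \<in> mono_span Q f S"
  using mono_span.step[OF mono_span.zero] by fastforce

lemma mono_span_add:
  assumes "a \<in> mono_span Q f S" "b \<in> mono_span Q f S"
  shows "a + b \<in> mono_span Q f S"
  using assms(2)
proof induction
  case (step b c m)
  then show ?case using mono_span.step[of "a + b" Q f S c m] by (simp add: add.assoc)
qed (use assms(1) in simp)

lemma mono_span_shift:
  assumes "subfield Q amb" "a \<in> mono_span Q f S" "c \<in> Q" "\<And>m. m \<in> S \<Longrightarrow> n + m \<in> S'"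
  shows "c * monomial f n * a \<in> mono_span Q f S'"
  using assms(2)
proof induction
  case (step a d m)
  then have "c * monomial f n * a + (c * d) * monomial f (n + m) \<in> mono_span Q f S'"
    using assms sf_mult[OF assms(1)] by (intro mono_span.step) auto
  then show ?case by (simp add: monomial_add algebra_simps)
qed (simp add: mono_span.zero)

lemma mono_span_mult:
  assumes "subfield Q amb" "a \<in> mono_span Q f S" "b \<in> mono_span Q f S"
    "\<And>m n. m \<in> S \<Longrightarrow> n \<in> S \<Longrightarrow> m + n \<in> S"
  shows "a * b \<in> mono_span Q f S"
  using assms(2)
proof induction
  case (step a c m)
  then have "a * b + c * monomial f m * b \<in> mono_span Q f S"
    using assms mono_span_shift[OF assms(1,3)] by (intro mono_span_add) auto
  then show ?case by (simp add: algebra_simps)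
qed (simp add: mono_span.zero)

text \<open>The inductive description of the span makes sums and products easy; algebraic independence
  speaks of polynomials, to which this returns.\<close>

lemma mono_span_poly:
  assumes "subfield Q amb" "a \<in> mono_span Q f S"
  obtains P where "\<forall>m. Poly_Mapping.lookup P m \<in> Q" "Poly_Mapping.keys P \<subseteq> S" "a = eval_mpoly f P"
  using assms(2)
proof (induction arbitrary: thesis)
  case zero
  then show ?case using sf_zero[OF assms(1)] by (intro zero[of 0]) (auto simp: eval_mpoly_def)
next
  case (step a c m)
  obtain P where P: "\<forall>m. Poly_Mapping.lookup P m \<in> Q" "Poly_Mapping.keys P \<subseteq> S" "a = eval_mpoly f P"
    using step.IH .
  show ?case
  proof (rule step.prems)
    show "\<forall>n. Poly_Mapping.lookup (P + Poly_Mapping.single m c) n \<in> Q"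
      using P(1) \<open>c \<in> Q\<close> sf_add[OF assms(1)] sf_zero[OF assms(1)]
      by (auto simp: lookup_add lookup_single when_def)
    show "Poly_Mapping.keys (P + Poly_Mapping.single m c) \<subseteq> S"
      using Poly_Mapping.keys_add[of P "Poly_Mapping.single m c"] P(2) \<open>m \<in> S\<close>
      by (auto split: if_splits)
    show "a + c * monomial f m = eval_mpoly f (P + Poly_Mapping.single m c)"
      by (simp add: P(3) eval_mpoly_add eval_mpoly_single)
  qed
qed

lemma fractions_subfield:
  fixes A :: "'a :: field set"
  assumes "1 \<in> A" "\<And>x y. x \<in> A \<Longrightarrow> y \<in> A \<Longrightarrow> x + y \<in> A" "\<And>x. x \<in> A \<Longrightarrow> - x \<in> A"
    "\<And>x y. x \<in> A \<Longrightarrow> y \<in> A \<Longrightarrow> x * y \<in> A"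
  shows "subfield {g / h | g h. g \<in> A \<and> h \<in> A \<and> h \<noteq> 0} amb" (is "subfield ?R _")
proof (rule subfield_ambI)
  have I: "g / h \<in> ?R" if "g \<in> A" "h \<in> A" "h \<noteq> 0" for g h using that by blast
  show "1 \<in> ?R" using I[of 1 1] assms(1) by simp
  fix x assume "x \<in> ?R"
  then obtain g h where x: "x = g / h" "g \<in> A" "h \<in> A" "h \<noteq> 0" by blast
  show "- x \<in> ?R" using I[of "- g" h] x assms(3) by simp
  show "inverse x \<in> ?R" if "x \<noteq> 0" using I[of h g] x that by auto
  fix y assume "y \<in> ?R"
  then obtain g' h' where y: "y = g' / h'" "g' \<in> A" "h' \<in> A" "h' \<noteq> 0" by blast
  show "x + y \<in> ?R" using I[of "g * h' + g' * h" "h * h'"] x y assms by (simp add: add_frac_eq)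
  show "x * y \<in> ?R" using I[of "g * g'" "h * h'"] x y assms by simp
qed

locale independent_family = char_p p ty for p :: nat and ty :: "'a :: field itself" +
  fixes Q :: "'a set" and I :: "'v set" and f :: "'v \<Rightarrow> 'a"
  assumes Q: "subfield Q amb" and indep: "alg_independent Q I f"
begin

lemma mono_span_disjoint:
  assumes "a \<in> mono_span Q f S" "a \<in> mono_span Q f T" "S \<inter> T = {}"
    "\<And>m. m \<in> S \<union> T \<Longrightarrow> Poly_Mapping.keys m \<subseteq> I"
  shows "a = 0"
proof -
  obtain P where P: "\<forall>m. Poly_Mapping.lookup P m \<in> Q" "Poly_Mapping.keys P \<subseteq> S" "a = eval_mpoly f P"
    using mono_span_poly[OF Q assms(1)] .
  obtain R where R: "\<forall>m. Poly_Mapping.lookup R m \<in> Q" "Poly_Mapping.keys R \<subseteq> T" "a = eval_mpoly f R"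
    using mono_span_poly[OF Q assms(2)] .
  have "P - R = 0"
  proof (rule indep[unfolded alg_independent_def, rule_format])
    show "Poly_Mapping.lookup (P - R) m \<in> Q" for m
      using P(1) R(1) sf_diff[OF Q] by (simp add: lookup_minus)
    show "Poly_Mapping.keys m \<subseteq> I" if "m \<in> Poly_Mapping.keys (P - R)" for m
      using that Poly_Mapping.keys_diff[of P R] P(2) R(2) assms(4) by blast
    show "eval_mpoly f (P - R) = 0" using P(3) R(3) by (simp add: eval_mpoly_diff)
  qed
  then have "P = R" by simp
  then have "Poly_Mapping.keys P = {}" using P(2) R(2) assms(3) by blast
  then show ?thesis using P(3) by (simp add: eval_mpoly_def)
qed

text \<open>The monomials whose exponent in \<open>v\<close> is a multiple of \<open>d\<close> span a subring \<open>A\<close> whose fractions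
  contain the field in question.  From \<open>f v ^ n = g / h\<close> with \<open>g, h \<in> A\<close> one gets
  \<open>f v ^ n * h = g\<close>, where on the left the exponents of \<open>v\<close> are congruent to \<open>n\<close> modulo \<open>d\<close> and
  on the right to \<open>0\<close>.\<close>

lemma variable_power_notin:
  assumes v: "v \<in> I" and nd: "\<not> d dvd n"
  shows "f v ^ n \<notin> fld (Q \<union> f ` (I - {v}) \<union> {f v ^ d})"
proof
  assume mem: "f v ^ n \<in> fld (Q \<union> f ` (I - {v}) \<union> {f v ^ d})"
  define S where "S = {m :: 'v \<Rightarrow>\<^sub>0 nat. Poly_Mapping.keys m \<subseteq> I \<and> d dvd Poly_Mapping.lookup m v}"
  define S' where "S' = {m :: 'v \<Rightarrow>\<^sub>0 nat. Poly_Mapping.keys m \<subseteq> I \<and> \<not> d dvd Poly_Mapping.lookup m v}"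
  define A where "A = mono_span Q f S"
  have S_add: "m + m' \<in> S" if "m \<in> S" "m' \<in> S" for m m'
    using that Poly_Mapping.keys_add[of m m'] by (auto simp: S_def lookup_add)
  have "0 \<in> S" by (simp add: S_def)
  have QA: "c \<in> A" if "c \<in> Q" for c
    using mono_span_single[OF that \<open>0 \<in> S\<close>, of f] by (simp add: A_def monomial_def)
  have multA: "x * y \<in> A" if "x \<in> A" "y \<in> A" for x y
    using that mono_span_mult[OF Q _ _ S_add] unfolding A_def by blast
  have R: "subfield {g / h | g h. g \<in> A \<and> h \<in> A \<and> h \<noteq> 0} amb" (is "subfield ?R _")
  proof (rule fractions_subfield)
    show "1 \<in> A" by (rule QA[OF sf_one[OF Q]])
    show "- x \<in> A" if "x \<in> A" for x
      using multA[OF QA[OF sf_uminus[OF Q sf_one[OF Q]]] that] by simp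
  qed (use multA mono_span_add in \<open>auto simp: A_def\<close>)
  have AR: "x \<in> ?R" if "x \<in> A" for x
    using that QA[OF sf_one[OF Q]] by (metis (mono_tags, lifting) div_by_1 mem_Collect_eq one_neq_zero)
  have var: "f w ^ k \<in> A" if "Poly_Mapping.single w k \<in> S" for w k
    using mono_span_single[OF sf_one[OF Q] that, of f] by (simp add: A_def monomial_single)
  have "fld (Q \<union> f ` (I - {v}) \<union> {f v ^ d}) \<subseteq> ?R"
  proof (rule fld_least[OF R])
    have "f w \<in> A" if "w \<in> I - {v}" for w
      using var[of w 1] that by (simp add: S_def lookup_single when_def)
    moreover have "f v ^ d \<in> A" using var[of v d] v by (simp add: S_def)
    ultimately show "Q \<union> f ` (I - {v}) \<union> {f v ^ d} \<subseteq> ?R" using QA AR by blast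
  qed
  with mem obtain g h where gh: "f v ^ n = g / h" "g \<in> A" "h \<in> A" "h \<noteq> 0" by blast
  have shift: "Poly_Mapping.single v n + m \<in> S'" if "m \<in> S" for m
  proof -
    have "Poly_Mapping.keys (Poly_Mapping.single v n + m) \<subseteq> insert v (Poly_Mapping.keys m)"
      using Poly_Mapping.keys_add[of "Poly_Mapping.single v n" m] by (auto split: if_splits)
    then show ?thesis
      using that v nd by (auto simp: S_def S'_def lookup_add dvd_add_left_iff)
  qed
  have "1 * monomial f (Poly_Mapping.single v n) * h \<in> mono_span Q f S'"
    by (rule mono_span_shift[OF Q _ sf_one[OF Q] shift]) (use gh(3) in \<open>simp_all add: A_def\<close>)
  moreover have "1 * monomial f (Poly_Mapping.single v n) * h = g"
    using gh by (simp add: monomial_single)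
  ultimately have "g \<in> mono_span Q f S'" by simp
  then have "g = 0"
    using gh(2) unfolding A_def
    by (rule mono_span_disjoint) (auto simp: S_def S'_def)
  have "f v ^ n = 0" using gh \<open>g = 0\<close> by simp
  \<comment> \<open>A vanishing power of the variable is itself a polynomial relation.\<close>
  have "1 = (0::'a)"
  proof -
    define m where "m = Poly_Mapping.single (Poly_Mapping.single v n) (1::'a)"
    have "m = 0"
    proof (rule indep[unfolded alg_independent_def, rule_format])
      show "Poly_Mapping.lookup m k \<in> Q" for k
        using sf_closed(1,2)[OF Q] by (simp add: m_def lookup_single when_def)
      show "Poly_Mapping.keys k \<subseteq> I" if "k \<in> Poly_Mapping.keys m" for k
        using that v by (auto simp: m_def split: if_splits)
      show "eval_mpoly f m = 0"
        using \<open>f v ^ n = 0\<close> by (simp add: m_def eval_mpoly_single monomial_single)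
    qed
    then show ?thesis unfolding m_def by (metis lookup_single_eq lookup_zero)
  qed
  then show False by simp
qed

lemma variable_nonzero:
  assumes "v \<in> I"
  shows "f v \<noteq> 0"
proof
  assume "f v = 0"
  then have "f v ^ 1 \<in> fld (Q \<union> f ` (I - {v}) \<union> {f v ^ 2})"
    using sf_zero[OF fld_subfield] by simp
  moreover have "\<not> (2::nat) dvd 1" by simp
  ultimately show False using variable_power_notin[OF assms] by blast
qed

text \<open>Everything that, up to a purely inseparable extension, depends on the variable \<open>v\<close> only
  through its power with exponent \<open>p * t\<close>.  The \<open>p ^ M\<close>-th power is matched by the same power of
  that generator, for otherwise \<open>f v ^ t\<close> itself would belong to the set.\<close>

definition away :: "'v \<Rightarrow> nat \<Rightarrow> 'a set"
  where "away v t = {c. \<exists>M. c ^ (p ^ M) \<in> fld (Q \<union> f ` (I - {v}) \<union> {f v ^ (p * t * p ^ M)})}"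

lemma away_step:
  assumes "c ^ (p ^ M) \<in> fld (Q \<union> f ` (I - {v}) \<union> {f v ^ (p * t * p ^ M)})" "M \<le> N"
  shows "c ^ (p ^ N) \<in> fld (Q \<union> f ` (I - {v}) \<union> {f v ^ (p * t * p ^ N)})"
  using assms(2,1)
proof (induction rule: dec_induct)
  case (step N)
  let ?G = "fld (Q \<union> f ` (I - {v}) \<union> {f v ^ (p * t * p ^ Suc N)})"
  have G: "subfield ?G amb" by (rule fld_subfield)
  have "(c ^ (p ^ N)) ^ (p ^ 1) \<in> ?G"
  proof (rule frob_fld[OF _ G step.IH[OF step.prems]])
    fix s assume s: "s \<in> Q \<union> f ` (I - {v}) \<union> {f v ^ (p * t * p ^ N)}"
    show "s ^ (p ^ 1) \<in> ?G"
    proof (cases "s = f v ^ (p * t * p ^ N)")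
      case True
      then have "s ^ (p ^ 1) = f v ^ (p * t * p ^ Suc N)" by (simp add: algebra_simps flip: power_mult)
      then show ?thesis by (auto intro: fld_incl)
    next
      case False
      then have "s \<in> ?G" using s by (auto intro: fld_incl)
      then show ?thesis by (rule sf_power[OF G])
    qed
  qed
  then show ?case by (simp add: mult.commute flip: power_mult)
qed

lemma away_subfield: "subfield (away v t) (amb :: 'a ring)"
proof (rule subfield_ambI)
  let ?G = "\<lambda>M. fld (Q \<union> f ` (I - {v}) \<union> {f v ^ (p * t * p ^ M)})"
  have G: "subfield (?G M) amb" for M by (rule fld_subfield)
  show "1 \<in> away v t" unfolding away_def using sf_one[OF G] by auto
  fix x assume "x \<in> away v t"
  then obtain M where x: "x ^ (p ^ M) \<in> ?G M" by (auto simp: away_def)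
  show "- x \<in> away v t"
    unfolding away_def using sf_uminus[OF G x] by (auto simp flip: frob_uminus)
  show "inverse x \<in> away v t"
    unfolding away_def using sf_inverse[OF G x] by (auto simp: power_inverse)
  fix y assume "y \<in> away v t"
  then obtain N where y: "y ^ (p ^ N) \<in> ?G N" by (auto simp: away_def)
  define L where "L = max M N"
  have L: "x ^ (p ^ L) \<in> ?G L" "y ^ (p ^ L) \<in> ?G L"
    using away_step[OF x] away_step[OF y] by (auto simp: L_def)
  show "x + y \<in> away v t" unfolding away_def using sf_add[OF G L] by (auto simp flip: frob_add)
  show "x * y \<in> away v t" unfolding away_def using sf_mult[OF G L] by (auto simp: power_mult_distrib)
qed

lemma variable_notin_away:
  assumes "v \<in> I" "t > 0"
  shows "f v ^ t \<notin> away v t"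
proof
  assume "f v ^ t \<in> away v t"
  then obtain M where "(f v ^ t) ^ (p ^ M) \<in> fld (Q \<union> f ` (I - {v}) \<union> {f v ^ (p * t * p ^ M)})"
    by (auto simp: away_def)
  then have M: "f v ^ (t * p ^ M) \<in> fld (Q \<union> f ` (I - {v}) \<union> {f v ^ (p * t * p ^ M)})"
    by (simp flip: power_mult)
  have "t * p ^ M > 0" "t * p ^ M < p * (t * p ^ M)" using assms(2) p_ge2 by simp_all
  then have "\<not> p * t * p ^ M dvd t * p ^ M"
    by (metis dvd_imp_le mult.assoc not_le)
  then show False using variable_power_notin[OF assms(1)] M by blast
qed

lemma away_of_root:
  assumes "c ^ (p ^ M) \<in> fld (Q \<union> f ` (I - {v}))"
  shows "c \<in> away v t"
  using fld_mono[of "Q \<union> f ` (I - {v})" "Q \<union> f ` (I - {v}) \<union> {f v ^ (p * t * p ^ M)}"] assms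
  unfolding away_def by blast

lemma variable_power_in_away: "f v ^ (p * t) \<in> away v t"
  unfolding away_def by (auto intro!: exI[of _ 0] fld_incl)

end

section \<open>Perfect closures inside the ambient field\<close>

context char_p
begin

definition pinsep :: "'a set \<Rightarrow> 'a set"
  where "pinsep F = {c. \<exists>M. c ^ (p ^ M) \<in> F}"

lemma pinsep_subfield:
  assumes "subfield F (amb :: 'a ring)"
  shows "subfield (pinsep F) amb"
proof -
  have "subfield (\<Union>M\<in>UNIV. {c. c ^ (p ^ M) \<in> F}) amb"
    by (rule subfield_UN_chain) (use frob_preimage_subfield[OF assms] frob_mono[OF assms] in auto)
  moreover have "(\<Union>M\<in>UNIV. {c. c ^ (p ^ M) \<in> F}) = pinsep F" by (auto simp: pinsep_def)
  ultimately show ?thesis by simp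
qed

lemma pinsep_incl: "F \<subseteq> pinsep F"
  unfolding pinsep_def by (auto intro!: exI[of _ 0])

lemma pinsep_root:
  assumes "c ^ p \<in> pinsep F"
  shows "c \<in> pinsep F"
proof -
  obtain M where "(c ^ p) ^ (p ^ M) \<in> F" using assms by (auto simp: pinsep_def)
  then have "c ^ (p ^ Suc M) \<in> F" by (simp only: frob_Suc)
  then show ?thesis unfolding pinsep_def by blast
qed

end

section \<open>The tower and the exponents of its generators\<close>

locale construction = char_p p ty for p :: nat and ty :: "'a :: field itself" +
  fixes Q :: "'a set" and x :: 'a and Z Y :: "nat \<Rightarrow> nat \<Rightarrow> 'a" and a :: "nat \<Rightarrow> 'a"
  assumes subfield_Q: "subfield Q amb"
    and alg_indep: "alg_independent Q indets (indet_val x Z Y)"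
    and root_exists: "\<exists>r. r ^ p = (y :: 'a)"
    and a_generates: "n \<ge> 1 \<Longrightarrow> adjoin Q {a n} = adjoin Q {proot p n x}"
begin

sublocale independent_family p ty Q indets "indet_val x Z Y"
  by (intro independent_family.intro independent_family_axioms.intro char_p_axioms subfield_Q alg_indep)

lemma proot_power: "proot p m y ^ (p ^ m) = (y :: 'a)"
proof -
  have "\<exists>r. r ^ (p ^ m) = y"
  proof (induction m arbitrary: y)
    case (Suc m)
    obtain u where "u ^ p = y" using root_exists by blast
    moreover obtain r where "r ^ (p ^ m) = u" using Suc by blast
    ultimately show ?case by (intro exI[of _ r]) (auto simp: mult.commute power_mult[symmetric])
  qed (use root_exists in simp)
  then have "\<exists>!r. r ^ (p ^ m) = y" using frob_inj by metis
  then show ?thesis unfolding proot_def by (rule theI')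
qed

text \<open>The generators \<open>\<theta>\<close> with the convention that index \<open>0\<close> gives \<open>0\<close> on every level, so that the
  recursion is uniform in \<open>i \<ge> 1\<close>, and \<open>\<theta>(n, i)\<close> has exponent \<open>i\<close> also for \<open>i = 0\<close>.\<close>

definition th :: "nat \<Rightarrow> nat \<Rightarrow> 'a"
  where "th n i = (if i = 0 then 0 else theta p a Z Y n i)"

lemma th_0 [simp]: "th n 0 = 0"
  by (simp add: th_def)

lemma th_rec:
  assumes "n \<ge> 1"
  shows "th (Suc n) (Suc i) ^ p
    = Z (Suc i) (Suc n) * th n (2 * Suc i) ^ p + th (Suc n) i + Y (Suc i) (Suc n)"
proof -
  have add: "(u + v) ^ p = u ^ p + v ^ p" for u v :: 'a
    using frob_add[of u v 1] by simp
  have root: "proot p 1 y ^ p = y" for y :: 'a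
    using proot_power[of 1 y] by simp
  show ?thesis
  proof (cases i)
    case 0
    then show ?thesis
      using theta_index_one[of "Suc n" p a Z Y] assms
      by (simp add: th_def add root[unfolded One_nat_def] power_mult_distrib)
  next
    case (Suc l)
    then show ?thesis
      using theta_index_step[of "Suc n" "Suc i" p a Z Y] assms
      by (simp add: th_def add root[unfolded One_nat_def] power_mult_distrib)
  qed
qed

text \<open>\<open>T n\<close> is the field \<open>K\<^sub>n\<close>, given by generators over \<open>Q\<close> rather than as an iterated union
  (\<open>tower_eq\<close>), and \<open>G n s\<close> is the field \<open>K\<^sub>n(\<theta>(n + 1, s))\<close>, the \<open>s\<close>-th stage between \<open>K\<^sub>n\<close> and
  \<open>K\<^sub>n\<^sub>+\<^sub>1\<close>.\<close>

definition gens :: "nat \<Rightarrow> 'a set"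
  where "gens n = {th m i | m i. 1 \<le> m \<and> m \<le> n}"

definition T :: "nat \<Rightarrow> 'a set"
  where "T n = fld (Q \<union> indet_val x Z Y ` indets \<union> gens n)"

definition G :: "nat \<Rightarrow> nat \<Rightarrow> 'a set"
  where "G n s = adjoin (T n) {th (Suc n) s}"

lemma T_subfield: "subfield (T n) amb" and G_subfield: "subfield (G n s) amb"
  by (simp_all add: T_def G_def fld_subfield)

lemma G_eq: "G n s = fld (Q \<union> indet_val x Z Y ` indets \<union> (gens n \<union> {th (Suc n) s}))"
  unfolding G_def T_def by (simp only: fld_Un_fld Un_assoc)

lemma T_incl_G: "T n \<subseteq> G n s" and th_in_G: "th (Suc n) s \<in> G n s"
  unfolding G_def by (auto intro: fld_incl)

lemma G_0: "G n 0 = T n"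
  unfolding G_def by (rule adjoin_absorb[OF T_subfield]) (simp add: sf_zero[OF T_subfield])

lemma T_mono: "n \<le> m \<Longrightarrow> T n \<subseteq> T m"
  unfolding T_def by (intro fld_mono) (auto simp: gens_def)

lemma th_in_T: "1 \<le> m \<Longrightarrow> m \<le> n \<Longrightarrow> th m i \<in> T n"
  unfolding T_def gens_def by (rule fld_incl) blast

lemma indet_in_T: "v \<in> indets \<Longrightarrow> indet_val x Z Y v \<in> T n"
  unfolding T_def by (intro fld_incl) auto

lemma IndZ_in: "i \<ge> 1 \<Longrightarrow> j \<ge> 2 \<Longrightarrow> IndZ i j \<in> indets"
  and IndY_in: "i \<ge> 1 \<Longrightarrow> j \<ge> 2 \<Longrightarrow> IndY i j \<in> indets"
  and IndX_in: "IndX \<in> indets"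
  by (auto simp: indets_def)

lemma Z_in_T: "i \<ge> 1 \<Longrightarrow> j \<ge> 2 \<Longrightarrow> Z i j \<in> T n" and Y_in_T: "i \<ge> 1 \<Longrightarrow> j \<ge> 2 \<Longrightarrow> Y i j \<in> T n"
  using indet_in_T[OF IndZ_in] indet_in_T[OF IndY_in] by simp_all

lemma Z_nonzero: "i \<ge> 1 \<Longrightarrow> j \<ge> 2 \<Longrightarrow> Z i j \<noteq> 0"
  using variable_nonzero[OF IndZ_in] by simp

lemma a_field_in: "adjoin Q {y} \<subseteq> adjoin (T 0) {y}"
  by (rule adjoin_least[OF fld_subfield]) (auto simp: T_def intro!: fld_incl)

lemma Q_in_T: "Q \<subseteq> T n"
  unfolding T_def by (auto intro: fld_incl)

lemma
  shows root_in_a: "i \<ge> 1 \<Longrightarrow> proot p i x \<in> adjoin Q {a i}"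
    and a_in_root: "i \<ge> 1 \<Longrightarrow> a i \<in> adjoin Q {proot p i x}"
    and root_step: "proot p (Suc i) x ^ p = proot p i x"
proof -
  show "i \<ge> 1 \<Longrightarrow> proot p i x \<in> adjoin Q {a i}"
    by (subst a_generates) (auto intro: fld_incl)
  show "i \<ge> 1 \<Longrightarrow> a i \<in> adjoin Q {proot p i x}"
    by (subst a_generates[symmetric]) (auto intro: fld_incl)
  have "(proot p (Suc i) x ^ p) ^ (p ^ i) = proot p i x ^ (p ^ i)"
    by (simp only: frob_Suc[symmetric] proot_power)
  then show "proot p (Suc i) x ^ p = proot p i x" by (rule frob_inj)
qed

lemma frob_adjoin_Q:
  assumes "u \<in> adjoin Q {y}"
  shows "u ^ (p ^ m) \<in> adjoin Q {y ^ (p ^ m)}"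
proof (rule frob_fld[OF _ fld_subfield assms])
  show "s ^ (p ^ m) \<in> adjoin Q {y ^ (p ^ m)}" if "s \<in> Q \<union> {y}" for s
    using that sf_power[OF subfield_Q] by (auto intro: fld_incl)
qed

text \<open>Over \<open>K\<^sub>n\<close>, each generator is a rational function of the \<open>p\<close>-th power of the next one.  Above level one this
  is the recursion solved for its middle term; on level one it is the fact that
  \<open>Q(a\<^sub>i) = Q(x ^ (p ^ (- i)))\<close>.\<close>

lemma th_rel_perfect: "th (Suc n) i \<in> adjoin (T n) {th (Suc n) (Suc i) ^ p}"
proof (cases "i = 0")
  case True
  then show ?thesis by (simp add: sf_zero[OF fld_subfield])
next
  case False
  show ?thesis
  proof (cases n)
    case 0
    have "proot p (Suc i) x \<in> adjoin Q {a (Suc i)}" by (rule root_in_a) simp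
    from frob_adjoin_Q[OF this, of 1] have "proot p i x \<in> adjoin Q {a (Suc i) ^ p}"
      by (simp add: root_step)
    moreover have "Q \<subseteq> adjoin Q {a (Suc i) ^ p}" by (auto intro: fld_incl)
    ultimately have "adjoin Q {proot p i x} \<subseteq> adjoin Q {a (Suc i) ^ p}"
      by (intro adjoin_least[OF fld_subfield]) auto
    then have "a i \<in> adjoin Q {a (Suc i) ^ p}" using a_in_root[of i] False by auto
    then show ?thesis using a_field_in[of "a (Suc i) ^ p"] False by (auto simp: th_def 0)
  next
    case (Suc m)
    let ?E = "adjoin (T n) {th (Suc n) (Suc i) ^ p}"
    have E: "subfield ?E amb" by (rule fld_subfield)
    have TE: "u \<in> ?E" if "u \<in> T n" for u using that by (auto intro: fld_incl)
    have "th (Suc n) i = th (Suc n) (Suc i) ^ p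
        - (Z (Suc i) (Suc n) * th n (2 * Suc i) ^ p + Y (Suc i) (Suc n))"
      using th_rec[of n i] Suc by simp
    also have "\<dots> \<in> ?E"
    proof (rule sf_diff[OF E])
      show "th (Suc n) (Suc i) ^ p \<in> ?E" by (auto intro: fld_incl)
      show "Z (Suc i) (Suc n) * th n (2 * Suc i) ^ p + Y (Suc i) (Suc n) \<in> ?E"
        using Suc by (intro sf_add[OF E] sf_mult[OF E] sf_power[OF E] TE Z_in_T Y_in_T th_in_T) auto
    qed
    finally show ?thesis .
  qed
qed

lemma th_frob_in_G: "th (Suc n) (Suc i) ^ p \<in> G n i"
proof (cases n)
  case 0
  have "a (Suc i) ^ p \<in> adjoin Q {proot p i x}"
    using frob_adjoin_Q[OF a_in_root[of "Suc i"], of 1] by (simp add: root_step)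
  also have "adjoin Q {proot p i x} \<subseteq> G 0 i"
  proof (cases "i = 0")
    case True
    have "proot p 0 x = x" using proot_power[of 0 x] by simp
    then show ?thesis
      using Q_in_T[of 0] indet_in_T[OF IndX_in, of 0]
      by (simp add: True G_0) (intro fld_least[OF T_subfield], auto)
  next
    case False
    then show ?thesis
      using a_generates[of i] a_field_in[of "a i"] by (simp add: G_def th_def)
  qed
  finally show ?thesis by (simp add: 0 th_def)
next
  case (Suc m)
  have TG: "u \<in> G n i" if "u \<in> T n" for u using that T_incl_G by blast
  show ?thesis
  proof (subst th_rec)
    show "Z (Suc i) (Suc n) * th n (2 * Suc i) ^ p + th (Suc n) i + Y (Suc i) (Suc n) \<in> G n i"
      by (intro sf_add[OF G_subfield] sf_mult[OF G_subfield] sf_power[OF G_subfield] th_in_G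
          TG[OF Z_in_T] TG[OF Y_in_T] TG[OF th_in_T]) (simp_all add: Suc)
  qed (simp add: Suc)
qed

lemma G_mono: "i \<le> j \<Longrightarrow> G n i \<subseteq> G n j"
proof (induction rule: dec_induct)
  case (step j)
  have "adjoin (T n) {th (Suc n) (Suc j) ^ p} \<subseteq> G n (Suc j)"
    by (rule adjoin_least[OF G_subfield T_incl_G]) (use sf_power[OF G_subfield] th_in_G in auto)
  then have "th (Suc n) j \<in> G n (Suc j)" using th_rel_perfect by blast
  then have "G n j \<subseteq> G n (Suc j)"
    unfolding G_def[of n j] by (intro adjoin_least[OF G_subfield T_incl_G]) auto
  with step.IH show ?case by blast
qed simp

lemma G_incl_T: "G n i \<subseteq> T (Suc n)"
  unfolding G_def by (rule adjoin_least[OF T_subfield]) (auto simp: T_mono th_in_T T_mono[THEN subsetD])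

lemma T_Suc: "T (Suc n) = (\<Union>i. G n i)"
proof
  have "gens (Suc n) \<subseteq> gens n \<union> range (th (Suc n))"
    by (auto simp: gens_def le_Suc_eq)
  moreover have "range (th (Suc n)) \<subseteq> (\<Union>i. G n i)" using th_in_G by blast
  moreover have "Q \<union> indet_val x Z Y ` indets \<union> gens n \<subseteq> (\<Union>i. G n i)"
    using T_incl_G[of n 0] by (auto simp: T_def intro: fld_incl)
  ultimately have "Q \<union> indet_val x Z Y ` indets \<union> gens (Suc n) \<subseteq> (\<Union>i. G n i)" by blast
  moreover have "subfield (\<Union>i. G n i) amb"
    by (rule subfield_UN_chain) (auto simp: G_subfield intro: G_mono[THEN subsetD])
  ultimately show "T (Suc n) \<subseteq> (\<Union>i. G n i)" unfolding T_def by (intro fld_least)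
qed (use G_incl_T in blast)

lemma tower_eq: "tower (base_field Q x Z Y) p a Z Y n = T n"
proof (induction n)
  case 0
  have "gens 0 = {}" by (auto simp: gens_def)
  then show ?case by (simp add: base_field_def T_def)
next
  case (Suc n)
  have "T (Suc n) = (\<Union>i\<in>{1..}. G n i)"
  proof -
    have "G n i \<subseteq> (\<Union>i\<in>{1..}. G n i)" for i
      using G_mono[of i "Suc i" n] by auto
    then show ?thesis unfolding T_Suc by blast
  qed
  then show ?case by (simp add: Suc G_def th_def)
qed

text \<open>The indeterminates with indices \<open>(l, N)\<close> enter the construction with \<open>\<theta>(N, l)\<close>.\<close>

lemma th_pinsep:
  assumes "v \<in> {IndZ l N, IndY l N}" and "1 \<le> m" "m < N \<or> m = N \<and> i < l"
  shows "th m i \<in> pinsep (fld (Q \<union> indet_val x Z Y ` (indets - {v})))"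
  using assms(2,3)
proof (induction m arbitrary: i rule: dec_induct)
  let ?R = "pinsep (fld (Q \<union> indet_val x Z Y ` (indets - {v})))"
  have R: "subfield ?R amb" by (intro pinsep_subfield fld_subfield)
  have QR: "Q \<union> indet_val x Z Y ` (indets - {v}) \<subseteq> ?R"
    using fld_incl pinsep_incl by (rule subset_trans[OF subsetI])
  {
    case base
    show ?case
    proof (cases "i = 0")
      case False
      have "x \<in> indet_val x Z Y ` (indets - {v})"
        using assms(1) IndX_in by (auto intro!: image_eqI[of _ _ IndX])
      then have "proot p i x ^ (p ^ i) \<in> fld (Q \<union> indet_val x Z Y ` (indets - {v}))"
        by (simp add: proot_power fld_incl)
      then have "proot p i x \<in> ?R" unfolding pinsep_def by blast
      then have "adjoin Q {proot p i x} \<subseteq> ?R"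
        using QR by (intro adjoin_least[OF R]) auto
      then show ?thesis using False a_in_root[of i] by (auto simp: th_def)
    qed (simp add: sf_zero[OF R])
  next
    case (step n)
    show ?case
      using step.prems
    proof (induction i)
      case 0
      show ?case by (simp add: sf_zero[OF R])
    next
      case (Suc i)
      have "Z (Suc i) (Suc n) \<in> indet_val x Z Y ` (indets - {v})"
        using assms(1) Suc.prems step.hyps IndZ_in[of "Suc i" "Suc n"]
        by (intro image_eqI[of _ _ "IndZ (Suc i) (Suc n)"]) auto
      moreover have "Y (Suc i) (Suc n) \<in> indet_val x Z Y ` (indets - {v})"
        using assms(1) Suc.prems step.hyps IndY_in[of "Suc i" "Suc n"]
        by (intro image_eqI[of _ _ "IndY (Suc i) (Suc n)"]) auto
      moreover have "th n (2 * Suc i) \<in> ?R" using step.IH Suc.prems by auto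
      moreover have "th (Suc n) i \<in> ?R" using Suc by auto
      ultimately have "th (Suc n) (Suc i) ^ p \<in> ?R"
        using QR step.hyps
        by (subst th_rec) (auto intro!: sf_add[OF R] sf_mult[OF R] sf_power[OF R])
      then show ?case by (rule pinsep_root)
    qed
  }
qed

lemma th_away:
  assumes "v \<in> {IndZ l N, IndY l N}" and "1 \<le> m" "m < N \<or> m = N \<and> i < l"
  shows "th m i \<in> away v t"
  using th_pinsep[OF assms] away_of_root unfolding pinsep_def by blast

lemma Q_away: "Q \<subseteq> away v t"
proof
  fix c assume "c \<in> Q"
  then have "c ^ (p ^ 0) \<in> fld (Q \<union> indet_val x Z Y ` (indets - {v}))" by (simp add: fld_incl)
  then show "c \<in> away v t" by (rule away_of_root)
qed

lemma indet_away: "w \<in> indets \<Longrightarrow> w \<noteq> v \<Longrightarrow> indet_val x Z Y w \<in> away v t"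
  by (rule away_of_root[of _ 0]) (simp add: fld_incl)

text \<open>A new indeterminate, \<open>x\<close> itself or the \<open>Y\<close> of index \<open>(1, n + 1)\<close>, appears to the first power in
  \<open>\<theta>(n + 1, 1) ^ p\<close>, while \<open>p\<close>-th powers of elements of \<open>K\<^sub>n\<close> involve it only through its
  \<open>p\<close>-th power.\<close>

lemma th_one_notin: "th (Suc n) 1 \<notin> T n"
proof
  assume mem: "th (Suc n) 1 \<in> T n"
  show False
  proof (cases n)
    case 0
    have "proot p 1 x \<in> adjoin Q {a 1}" by (rule root_in_a) simp
    also have "adjoin Q {a 1} \<subseteq> T 0"
      using mem Q_in_T[of 0] by (intro adjoin_least[OF T_subfield]) (auto simp: 0 th_def)
    finally have "proot p 1 x ^ (p ^ 1) \<in> away IndX 1"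
      unfolding T_def
    proof (rule frob_fld[OF _ away_subfield, rotated])
      fix s assume s: "s \<in> Q \<union> indet_val x Z Y ` indets \<union> gens 0"
      then consider "s \<in> Q" | w where "w \<in> indets" "s = indet_val x Z Y w"
        by (auto simp: gens_def)
      then show "s ^ (p ^ 1) \<in> away IndX 1"
      proof cases
        case 1
        then show ?thesis using Q_away sf_power[OF away_subfield] by blast
      next
        case (2 w)
        then show ?thesis
          using indet_away[of w IndX 1] sf_power[OF away_subfield] variable_power_in_away[of IndX 1]
          by (cases "w = IndX") auto
      qed
    qed
    then show False
      using variable_notin_away[OF IndX_in, of 1] proot_power[of 1 x] by simp
  next
    case (Suc m)
    define v where "v = IndY 1 (Suc n)"
    have v: "v \<in> indets" unfolding v_def by (rule IndY_in) (simp_all add: Suc)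
    note A = away_subfield[of v 1]
    have th_v: "th l i \<in> away v 1" if "1 \<le> l" "l \<le> n" for l i
      by (rule th_away[of _ 1 "Suc n"]) (use that in \<open>auto simp: v_def\<close>)
    have "th (Suc n) 1 ^ (p ^ 1) \<in> away v 1"
    proof (rule frob_fld[OF _ A mem[unfolded T_def]])
      fix s assume s: "s \<in> Q \<union> indet_val x Z Y ` indets \<union> gens n"
      then consider "s \<in> Q" | w where "w \<in> indets" "s = indet_val x Z Y w" | "s \<in> gens n"
        by auto
      then show "s ^ (p ^ 1) \<in> away v 1"
      proof cases
        case 1
        then show ?thesis using Q_away sf_power[OF A] by blast
      next
        case (2 w)
        then show ?thesis
          using indet_away[of w v 1] sf_power[OF A] variable_power_in_away[of v 1]
          by (cases "w = v") auto
      next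
        case 3
        then show ?thesis using th_v sf_power[OF A] by (auto simp: gens_def)
      qed
    qed
    then have "Z 1 (Suc n) * th n 2 ^ p + Y 1 (Suc n) \<in> away v 1"
      using th_rec[of n 0] Suc by (simp add: numeral_2_eq_2)
    moreover have "Z 1 (Suc n) * th n 2 ^ p \<in> away v 1"
    proof (intro sf_mult[OF A] sf_power[OF A])
      show "Z 1 (Suc n) \<in> away v 1"
        using indet_away[OF IndZ_in[of 1 "Suc n"], of v 1] by (simp add: v_def Suc)
      show "th n 2 \<in> away v 1" by (rule th_v) (simp_all add: Suc)
    qed
    ultimately have "Y 1 (Suc n) \<in> away v 1" by (rule sf_add_cancel[OF A])
    then show False using variable_notin_away[OF v, of 1] by (simp add: v_def)
  qed
qed

lemma th_exponent: "th (Suc n) i ^ (p ^ m) \<in> T n \<longleftrightarrow> i \<le> m"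
proof
  have up: "th (Suc n) i ^ (p ^ i) \<in> T n" for i
  proof (induction i)
    case (Suc i)
    have "(th (Suc n) (Suc i) ^ p) ^ (p ^ i) \<in> T n"
      by (rule frob_fld[OF _ T_subfield th_frob_in_G[unfolded G_def]])
         (use Suc sf_power[OF T_subfield] in auto)
    then show ?case by (simp add: power_mult)
  qed (simp add: sf_zero[OF T_subfield])
  show "i \<le> m \<Longrightarrow> th (Suc n) i ^ (p ^ m) \<in> T n"
    by (rule frob_mono[OF T_subfield up])
  have low: "th (Suc n) (Suc i) ^ (p ^ i) \<notin> T n" for i
  proof (induction i)
    case 0
    then show ?case using th_one_notin by simp
  next
    case (Suc i)
    show ?case
    proof
      assume "th (Suc n) (Suc (Suc i)) ^ (p ^ Suc i) \<in> T n"
      then have "(th (Suc n) (Suc (Suc i)) ^ p) ^ (p ^ i) \<in> T n" by (simp add: power_mult)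
      then have "th (Suc n) (Suc i) ^ (p ^ i) \<in> T n"
        by (intro frob_fld[OF _ T_subfield th_rel_perfect]) (use sf_power[OF T_subfield] in auto)
      then show False using Suc by simp
    qed
  qed
  show "i \<le> m" if "th (Suc n) i ^ (p ^ m) \<in> T n"
  proof (rule ccontr)
    assume "\<not> i \<le> m"
    then obtain i' where i': "i = Suc i'" "m \<le> i'" by (cases i) auto
    then show False using low[of i'] frob_mono[OF T_subfield that, of i'] by simp
  qed
qed

text \<open>The exponent of \<open>\<theta>(n + 1 + d, i)\<close> over \<open>K\<^sub>n\<close> is \<open>2 ^ d * i\<close>: in the recursion the term with the
  doubled index \<open>2 * i\<close> on the level below has the largest exponent, the other two being absorbed
  one power earlier.\<close>

lemma th_exponent_below: "th (Suc (n + d)) i ^ (p ^ m) \<in> T n \<longleftrightarrow> 2 ^ d * i \<le> m"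
proof (induction d arbitrary: i m)
  case 0
  then show ?case by (simp add: th_exponent)
next
  case (Suc d)
  have rec: "th (Suc (n + Suc d)) (Suc i) ^ (p ^ Suc m)
      = Z (Suc i) (Suc (n + Suc d)) ^ (p ^ m) * th (Suc (n + d)) (2 * Suc i) ^ (p ^ Suc m)
        + (th (Suc (n + Suc d)) i ^ (p ^ m) + Y (Suc i) (Suc (n + Suc d)) ^ (p ^ m))" for i m
    unfolding frob_Suc
    by (subst th_rec) (simp_all add: frob_add power_mult_distrib add.assoc)
  have ZY: "Z (Suc i) (Suc (n + Suc d)) ^ (p ^ m) \<in> T n" "Y (Suc i) (Suc (n + Suc d)) ^ (p ^ m) \<in> T n"
    for i m by (intro sf_power[OF T_subfield] Z_in_T Y_in_T; simp)+
  note below = Suc.IH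
  have up: "th (Suc (n + Suc d)) i ^ (p ^ m) \<in> T n" if "2 ^ Suc d * i \<le> m" for i m
    using that
  proof (induction i arbitrary: m)
    case 0
    then show ?case using p_pos by (simp add: power_0_left sf_zero[OF T_subfield])
  next
    case (Suc i)
    then obtain m' where m: "m = Suc m'" by (cases m) auto
    have "(2::nat) ^ Suc d > 0" by simp
    moreover have "2 ^ Suc d * Suc i = 2 ^ Suc d * i + 2 ^ Suc d" by simp
    ultimately have le: "2 ^ Suc d * i \<le> m'" using Suc.prems unfolding m by linarith
    have le2: "2 ^ d * (2 * Suc i) \<le> m" using Suc.prems by (simp add: algebra_simps)
    show ?case
      unfolding m rec
      by (intro sf_add[OF T_subfield] sf_mult[OF T_subfield] ZY Suc.IH[OF le])
         (use below le2 in \<open>simp only: m\<close>)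
  qed
  show ?case
  proof
    assume mem: "th (Suc (n + Suc d)) i ^ (p ^ m) \<in> T n"
    show "2 ^ Suc d * i \<le> m"
    proof (rule ccontr)
      assume less: "\<not> 2 ^ Suc d * i \<le> m"
      then obtain i' where i: "i = Suc i'" by (cases i) auto
      define e where "e = (2::nat) ^ Suc d"
      have "e \<ge> 2" by (simp add: e_def)
      moreover have "e * i = e * i' + e" by (simp add: i)
      ultimately obtain m' where "e * i = Suc (Suc m')" "e * i' \<le> m'"
        by (intro that[of "e * i' + e - 2"]) linarith+
      then have m': "2 ^ Suc d * i = Suc (Suc m')" "2 ^ Suc d * i' \<le> m'"
        by (simp_all only: e_def)
      have "th (Suc (n + Suc d)) (Suc i') ^ (p ^ Suc m') \<in> T n"
        using frob_mono[OF T_subfield mem, of "Suc m'"] less m' by (simp add: i)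
      then have "Z (Suc i') (Suc (n + Suc d)) ^ (p ^ m') * th (Suc (n + d)) (2 * Suc i') ^ (p ^ Suc m') \<in> T n"
        unfolding rec using sf_add[OF T_subfield up[OF m'(2)] ZY(2)]
        by (subst (asm) add.commute) (rule sf_add_cancel[OF T_subfield])
      then have "th (Suc (n + d)) (2 * Suc i') ^ (p ^ Suc m') \<in> T n"
        by (rule sf_mult_cancel[OF T_subfield _ ZY(1)]) (simp add: Z_nonzero)
      then have "2 ^ d * (2 * Suc i') \<le> Suc m'" by (simp only: Suc.IH)
      then show False using m' by (simp add: i algebra_simps)
    qed
  qed (rule up)
qed

end

section \<open>Descent of exponents\<close>

lemma coeff_pcompose_shift:
  fixes H :: "'a :: field poly"
  assumes "degree H = Suc n"
  shows "coeff (pcompose H [:c, 1:]) n = coeff H n + of_nat (Suc n) * coeff H (Suc n) * c"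
proof -
  have deg: "degree ([:c, 1:] ^ i) = i" for i by (rule degree_linear_power)
  have "pcompose H [:c, 1:] = (\<Sum>i\<le>Suc n. smult (coeff H i) ([:c, 1:] ^ i))"
    unfolding pcompose_altdef poly_altdef
    by (subst degree_map_poly) (simp_all add: coeff_map_poly assms del: sum.atMost_Suc power_Suc)
  then have "coeff (pcompose H [:c, 1:]) n = (\<Sum>i\<le>Suc n. coeff H i * coeff ([:c, 1:] ^ i) n)"
    by (simp add: coeff_sum)
  also have "\<dots> = (\<Sum>i\<in>{n, Suc n}. coeff H i * coeff ([:c, 1:] ^ i) n)"
    by (rule sum.mono_neutral_right) (auto intro!: coeff_eq_0 simp: deg)
  also have "\<dots> = coeff H n + of_nat (Suc n) * coeff H (Suc n) * c"
    by (simp add: coeff_linear_poly_power del: power_Suc)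
  finally show ?thesis .
qed

context construction
begin

text \<open>The heart of the argument.  \<open>C\<close> contains the \<open>q\<close>-th powers of all coefficients, and \<open>z\<close>, \<open>y\<close>
  (the indeterminates of index \<open>(f, N + 1)\<close>) enter \<open>C\<close> only through \<open>z ^ q\<close> and \<open>y ^ q\<close>, whereas
  \<open>D\<close> is the corresponding field with \<open>D(z)(y) = G n s\<close>.  The \<open>q\<close>-th power of \<open>poly b \<theta>\<close>, for
  \<open>\<theta> = \<theta>(N + 1, f)\<close>, is a polynomial of degree below \<open>p\<close> in \<open>y ^ P + z ^ P * A + E\<close> over \<open>C\<close>, with
  \<open>A = \<theta>(N, 2 * f) ^ q\<close>.  Its top coefficient with respect to \<open>y ^ P\<close> is the \<open>q\<close>-th power \<open>l\<close> of the
  leading coefficient of \<open>b\<close>; the next one is linear in \<open>z ^ P\<close>, with slope a nonzero multiple of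
  \<open>l * A\<close>.  By \<open>coordinates_descend\<close>, first for \<open>y\<close> over \<open>C(z)\<close>, then for \<open>z\<close> over \<open>C\<close>, both \<open>l\<close> and
  \<open>A\<close> belong to \<open>G n s\<close>.\<close>

lemma descent_from_power:
  assumes n: "n < N" and f: "f \<ge> 1"
    and b: "poly_over (G N (f - 1)) b" "0 < degree b" "degree b < p"
    and w: "poly b (th (Suc N) f) ^ (p ^ Suc j) \<in> G n s"
  shows "lead_coeff b ^ (p ^ Suc j) \<in> G n s" "th N (2 * f) ^ (p ^ Suc j) \<in> G n s"
proof -
  define q P where "q = p ^ Suc j" and "P = p ^ j"
  have "q = p * P" by (simp add: q_def P_def)
  have "P > 0" using p_pos by (simp add: P_def)
  define vZ vY where "vZ = IndZ f (Suc N)" and "vY = IndY f (Suc N)"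
  define z y where "z = Z f (Suc N)" and "y = Y f (Suc N)"
  have v_in: "vZ \<in> indets" "vY \<in> indets"
    using IndZ_in[of f "Suc N"] IndY_in[of f "Suc N"] n f by (auto simp: vZ_def vY_def)
  have vals: "indet_val x Z Y vZ = z" "indet_val x Z Y vY = y" "vZ \<noteq> vY"
    by (simp_all add: vZ_def vY_def z_def y_def)
  define B where "B = Q \<union> indet_val x Z Y ` (indets - {vZ, vY}) \<union> {z ^ q, y ^ q}"
  define C where "C = fld (B \<union> (gens N \<union> {th (Suc N) (f - 1)}))"
  define D where "D = fld (B \<union> (gens n \<union> {th (Suc n) s}))"
  have C: "subfield C amb" and D: "subfield D amb" by (simp_all add: C_def D_def fld_subfield)
  have genC: "u \<in> C" if "u \<in> B \<union> (gens N \<union> {th (Suc N) (f - 1)})" for u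
    using that unfolding C_def by (rule fld_incl)
  have genD: "u \<in> D" if "u \<in> B \<union> (gens n \<union> {th (Suc n) s})" for u
    using that unfolding D_def by (rule fld_incl)
  have "gens n \<union> {th (Suc n) s} \<subseteq> gens N"
    using n unfolding gens_def by force
  then have "D \<subseteq> C" unfolding C_def D_def by (intro fld_mono) blast

  have C_away: "C \<subseteq> away v P" if v: "v \<in> {vZ, vY}" for v
    unfolding C_def
  proof (rule fld_least[OF away_subfield])
    note A = away_subfield[of v P]
    have v': "v \<in> {IndZ f (Suc N), IndY f (Suc N)}" using v by (simp add: vZ_def vY_def)
    have "indet_val x Z Y w ^ q \<in> away v P" if "w \<in> indets" for w
      using indet_away[of w v P] variable_power_in_away[of v P] sf_power[OF A] that \<open>q = p * P\<close>
      by (cases "w = v") auto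
    then have "{z ^ q, y ^ q} \<subseteq> away v P" using v_in vals by (metis empty_subsetI insert_subset)
    moreover have "indet_val x Z Y ` (indets - {vZ, vY}) \<subseteq> away v P"
      using v by (intro image_subsetI indet_away) auto
    moreover have "gens N \<subseteq> away v P"
      unfolding gens_def using th_away[OF v'] by auto
    moreover have "th (Suc N) (f - 1) \<in> away v P"
      by (rule th_away[OF v']) (use f in auto)
    ultimately show "B \<union> (gens N \<union> {th (Suc N) (f - 1)}) \<subseteq> away v P"
      using Q_away unfolding B_def by blast
  qed

  define CZ DZ where "CZ = adjoin C {z}" and "DZ = adjoin D {z}"
  have CZ: "subfield CZ amb" and DZ: "subfield DZ amb" by (simp_all add: CZ_def DZ_def fld_subfield)
  have C_CZ: "C \<subseteq> CZ" "z \<in> CZ" and D_DZ: "D \<subseteq> DZ" "z \<in> DZ"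
    by (auto simp: CZ_def DZ_def intro: fld_incl)
  have "DZ \<subseteq> CZ"
    unfolding DZ_def CZ_def using \<open>D \<subseteq> C\<close> by (intro fld_mono) blast
  have "CZ \<subseteq> away vY P"
    unfolding CZ_def using C_away[of vY] indet_away[OF v_in(1), of vY P] vals
    by (intro adjoin_least[OF away_subfield]) auto
  then have y_notin: "y ^ P \<notin> CZ"
    using variable_notin_away[OF v_in(2) \<open>P > 0\<close>] vals by auto
  have z_notin: "z ^ P \<notin> C"
    using variable_notin_away[OF v_in(1) \<open>P > 0\<close>] C_away[of vZ] vals by auto

  have gensG: "Q \<union> indet_val x Z Y ` indets \<union> (gens n \<union> {th (Suc n) s}) \<subseteq> G n s"
    unfolding G_eq by (intro subsetI fld_incl)
  have zyG: "z \<in> G n s" "y \<in> G n s" using gensG v_in vals by (metis Un_iff image_eqI subsetD)+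
  have "B \<subseteq> G n s"
    unfolding B_def using gensG zyG sf_power[OF G_subfield] by blast
  then have "D \<subseteq> G n s" unfolding D_def using gensG by (intro fld_least[OF G_subfield]) blast
  then have "DZ \<subseteq> G n s" unfolding DZ_def using zyG by (intro adjoin_least[OF G_subfield]) auto
  have G_sub: "G n s \<subseteq> adjoin DZ {y}"
    unfolding G_eq
  proof (rule fld_least[OF fld_subfield])
    have DZy: "DZ \<subseteq> adjoin DZ {y}" "y \<in> adjoin DZ {y}" by (auto intro: fld_incl)
    have "indet_val x Z Y w \<in> adjoin DZ {y}" if "w \<in> indets" for w
    proof (cases "w \<in> {vZ, vY}")
      case True
      then show ?thesis using vals DZy D_DZ by auto
    next
      case False
      then have "indet_val x Z Y w \<in> D" using that by (intro genD) (auto simp: B_def)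
      then show ?thesis using DZy D_DZ by blast
    qed
    moreover have "Q \<union> (gens n \<union> {th (Suc n) s}) \<subseteq> D" using genD by (auto simp: B_def)
    ultimately show "Q \<union> indet_val x Z Y ` indets \<union> (gens n \<union> {th (Suc n) s}) \<subseteq> adjoin DZ {y}"
      using DZy D_DZ by blast
  qed

  have frob_C: "u ^ q \<in> C" if u: "u \<in> G N (f - 1)" for u
    unfolding q_def
  proof (rule frob_fld[OF _ C u[unfolded G_eq]], fold q_def)
    fix r assume "r \<in> Q \<union> indet_val x Z Y ` indets \<union> (gens N \<union> {th (Suc N) (f - 1)})"
    then consider "r \<in> C" | "r = z" | "r = y"
      using vals genC unfolding B_def by blast
    then show "r ^ q \<in> C"
      by cases (use sf_power[OF C] genC in \<open>auto simp: B_def\<close>)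
  qed
  define A E where "A = th N (2 * f) ^ q" and "E = th (Suc N) (f - 1) ^ P"
  have AC: "A \<in> C" unfolding A_def using n by (intro sf_power[OF C] genC) (auto simp: gens_def)
  have EC: "E \<in> C" unfolding E_def by (intro sf_power[OF C] genC) auto
  define c where "c = z ^ P * A + E"
  have "c \<in> CZ"
    unfolding c_def using AC EC C_CZ by (intro sf_add[OF CZ] sf_mult[OF CZ] sf_power[OF CZ]) auto
  have th_q: "th (Suc N) f ^ q = y ^ P + c"
  proof -
    have "th (Suc N) f ^ p = z * th N (2 * f) ^ p + th (Suc N) (f - 1) + y"
      using th_rec[of N "f - 1"] n f by (simp add: z_def y_def)
    moreover have "th (Suc N) f ^ q = (th (Suc N) f ^ p) ^ P"
      unfolding q_def P_def by (rule frob_Suc)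
    moreover have "(th N (2 * f) ^ p) ^ P = A"
      unfolding A_def q_def P_def by (rule frob_Suc[symmetric])
    ultimately show ?thesis
      by (simp add: c_def E_def P_def frob_add power_mult_distrib)
  qed

  define H where "H = map_poly (\<lambda>u. u ^ q) b"
  have "q > 0" using p_pos by (simp add: q_def)
  have cH: "coeff H i = coeff b i ^ q" for i
    using \<open>q > 0\<close> by (simp add: H_def coeff_map_poly)
  have degH: "degree H = degree b"
    unfolding H_def by (rule degree_map_poly) simp
  have H_C: "coeff H i \<in> C" for i unfolding cH using b(1) frob_C by blast
  have "poly b (th (Suc N) f) ^ q = (\<Sum>i\<le>degree b. coeff b i ^ q * (th (Suc N) f ^ q) ^ i)"
    unfolding poly_altdef q_def frob_sum
    by (intro sum.cong refl) (simp add: power_mult_distrib mult.commute flip: power_mult)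
  also have "\<dots> = poly H (y ^ P + c)" unfolding poly_altdef cH degH th_q ..
  finally have wH: "poly b (th (Suc N) f) ^ q = poly (pcompose H [:c, 1:]) (y ^ P)"
    by (simp add: poly_pcompose add.commute)
  define g where "g = pcompose H [:c, 1:]"
  have deg_g: "degree g = degree b" by (simp add: g_def degree_pcompose degH)
  have g_DZ: "poly_over DZ g"
  proof (rule coordinates_descend[OF DZ CZ \<open>DZ \<subseteq> CZ\<close>, of y j])
    show "y ^ (p ^ Suc j) \<in> DZ"
      using genD[of "y ^ q"] D_DZ by (auto simp: B_def q_def)
    show "y ^ (p ^ j) \<notin> CZ" using y_notin by (simp add: P_def)
    show "poly_over CZ g"
      unfolding g_def
      by (intro allI coeff_pcompose_semiring_closed)
         (use H_C C_CZ \<open>c \<in> CZ\<close> sf_closed[OF CZ] poly_over_const[OF CZ] in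
           \<open>auto simp: coeff_pCons split: nat.split\<close>)
    show "degree g < p" using deg_g b(3) by simp
    show "poly g (y ^ (p ^ j)) \<in> adjoin DZ {y}"
      using w G_sub wH by (auto simp: g_def P_def q_def)
  qed

  obtain i where i: "degree b = Suc i" using b(2) by (cases "degree b") auto
  define l where "l = lead_coeff b ^ q"
  have "coeff g (Suc i) = l"
    using lead_coeff_comp[of "[:c, 1:]" H] deg_g degH cH by (simp add: g_def i l_def)
  then have "l \<in> DZ" using g_DZ by metis
  then show lG: "lead_coeff b ^ (p ^ Suc j) \<in> G n s"
    using \<open>DZ \<subseteq> G n s\<close> by (auto simp: l_def q_def)
  have "b \<noteq> 0" using b(2) by auto
  then have "l \<noteq> 0" by (simp add: l_def)
  have "l \<in> C" using H_C[of "Suc i"] by (simp add: cH l_def i)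
  have "coeff g i = coeff H i + of_nat (Suc i) * l * c"
    unfolding g_def by (subst coeff_pcompose_shift) (simp_all add: degH i cH l_def)
  also have "\<dots> = poly [:coeff H i + of_nat (Suc i) * l * E, of_nat (Suc i) * l * A:] (z ^ P)"
    by (simp add: c_def algebra_simps)
  finally have "poly [:coeff H i + of_nat (Suc i) * l * E, of_nat (Suc i) * l * A:] (z ^ P) \<in> DZ"
    using g_DZ by metis
  then have "poly_over D [:coeff H i + of_nat (Suc i) * l * E, of_nat (Suc i) * l * A:]"
  proof (intro coordinates_descend[OF D C \<open>D \<subseteq> C\<close>, of z j])
    show "z ^ (p ^ Suc j) \<in> D" using genD[of "z ^ q"] by (auto simp: B_def q_def)
    show "z ^ (p ^ j) \<notin> C" using z_notin by (simp add: P_def)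
    show "poly_over C [:coeff H i + of_nat (Suc i) * l * E, of_nat (Suc i) * l * A:]"
    proof -
      have "coeff H i + of_nat (Suc i) * l * E \<in> C" "of_nat (Suc i) * l * A \<in> C"
        using H_C \<open>l \<in> C\<close> EC AC by (intro sf_add[OF C] sf_mult[OF C] sf_of_nat[OF C]; simp)+
      then show ?thesis using sf_zero[OF C] by (auto simp: coeff_pCons split: nat.split)
    qed
    show "degree [:coeff H i + of_nat (Suc i) * l * E, of_nat (Suc i) * l * A:] < p"
      using p_ge2 by (intro le_less_trans[OF degree_pCons_le]) simp
  qed (simp_all add: DZ_def P_def)
  from this[rule_format, of 1] have "of_nat (Suc i) * l * A \<in> D" by simp
  then have "of_nat (Suc i) * l * A \<in> G n s" using \<open>D \<subseteq> G n s\<close> by blast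
  moreover have "of_nat (Suc i) * l \<in> G n s"
    using sf_mult[OF G_subfield sf_of_nat[OF G_subfield] lG] by (simp only: l_def q_def)
  moreover have "of_nat (Suc i) * l \<noteq> 0"
  proof -
    have "\<not> p dvd Suc i" using b(3) i by (auto dest: dvd_imp_le)
    then have "of_nat (Suc i) \<noteq> (0 :: 'a)" by (simp only: of_nat_eq_0_iff_char_dvd char simp_thms)
    then show ?thesis using \<open>l \<noteq> 0\<close> by (rule no_zero_divisors)
  qed
  ultimately have "A \<in> G n s" by (rule sf_mult_cancel[OF G_subfield])
  then show "th N (2 * f) ^ (p ^ Suc j) \<in> G n s" by (simp add: A_def q_def)
qed

lemma small_exponent_in_G:
  assumes "w \<in> T (Suc n)" "w ^ (p ^ s) \<in> T n"
  shows "w \<in> G n s"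
proof -
  obtain i where "w \<in> G n i" using assms(1) by (auto simp: T_Suc)
  define m where "m = max i s"
  have "w \<in> adjoin (T n) {th (Suc n) s}"
  proof (rule simple_ext_exponent_order[OF T_subfield _ _ _ assms(2)])
    show "th (Suc n) m ^ (p ^ m) \<in> T n" by (simp add: th_exponent)
    show "th (Suc n) s \<in> adjoin (T n) {th (Suc n) m}"
      using th_in_G G_mono[of s m n] by (auto simp: m_def G_def)
    show "w \<in> adjoin (T n) {th (Suc n) m}"
      using \<open>w \<in> G n i\<close> G_mono[of i m n] by (auto simp: m_def G_def)
    show "s = 0 \<or> th (Suc n) s ^ (p ^ (s - 1)) \<notin> T n" by (auto simp: th_exponent)
  qed
  then show ?thesis by (simp add: G_def)
qed

lemma G_frob:
  assumes "w \<in> G n s"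
  shows "w ^ (p ^ s) \<in> T n"
proof (rule frob_fld[OF _ T_subfield assms[unfolded G_def]])
  show "u ^ (p ^ s) \<in> T n" if "u \<in> T n \<union> {th (Suc n) s}" for u
    using that by (auto simp: th_exponent intro: sf_power[OF T_subfield])
qed

text \<open>Induction on the level \<open>N\<close>, then on \<open>f\<close> with \<open>w \<in> G N f\<close>, then on the degree of \<open>w\<close> as a
  polynomial in \<open>t = \<theta>(N + 1, f + 1)\<close> over \<open>G N f\<close>.  The membership obtained from
  \<open>descent_from_power\<close> bounds the exponents of \<open>t\<close> so that \<open>t ^ (p ^ j) \<in> K\<^sub>n\<^sub>+\<^sub>1\<close> and
  \<open>t ^ (p ^ (j + 1)) \<in> G n s\<close>; hence the leading term satisfies hypothesis and conclusion, and it
  can be subtracted from \<open>w\<close>.\<close>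

lemma exponent_descent:
  assumes "s \<le> j" "w \<in> T N" "w ^ (p ^ Suc j) \<in> G n s"
  shows "w ^ (p ^ j) \<in> T (Suc n)"
  using assms(2,3)
proof (induction N arbitrary: w)
  case 0
  then show ?case using T_mono[of 0 "Suc n"] sf_power[OF T_subfield] by blast
next
  case (Suc N)
  show ?case
  proof (cases "n < N")
    case False
    then show ?thesis using T_mono[of "Suc N" "Suc n"] Suc.prems sf_power[OF T_subfield] by auto
  next
    case True
    then obtain d where N: "N = Suc (n + d)" using less_iff_Suc_add by auto
    obtain f where "w \<in> G N f" using Suc.prems(1) by (auto simp: T_Suc)
    then show ?thesis
      using Suc.prems(2)
    proof (induction f arbitrary: w)
      case 0
      then show ?case using Suc.IH by (simp add: G_0)
    next
      case (Suc f)
      note IHf = Suc.IH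
      define t where "t = th (Suc N) (Suc f)"
      have "G N (Suc f) \<subseteq> adjoin (G N f) {t}"
        unfolding t_def G_def[of N "Suc f"] using T_incl_G by (intro fld_mono) blast
      then have "w \<in> adjoin (G N f) {t}" using Suc.prems(1) by blast
      moreover have "t ^ (p ^ 1) \<in> G N f" using th_frob_in_G by (simp add: t_def)
      ultimately obtain b where b: "poly_over (G N f) b" "degree b < p" "w = poly b t"
        using adjoin_root_as_poly[OF G_subfield] by (metis power_one_right)
      have "poly b t ^ (p ^ j) \<in> T (Suc n)" using b(1,2) Suc.prems(2)[unfolded b(3)]
      proof (induction "degree b" arbitrary: b rule: less_induct)
        case less
        show ?case
        proof (cases "degree b = 0")
          case True
          then obtain c where c: "b = [:c:]" by (rule degree_eq_zeroE)
          then have "c \<in> G N f" using less.prems(1)[rule_format, of 0] by simp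
          then show ?thesis using IHf less.prems(3) by (simp add: c)
        next
          case False
          define l where "l = lead_coeff b"
          have l: "l \<in> G N f" using less.prems(1) by (simp add: l_def)
          have desc: "l ^ (p ^ Suc j) \<in> G n s" "th N (2 * Suc f) ^ (p ^ Suc j) \<in> G n s"
            using descent_from_power[OF \<open>n < N\<close>, of "Suc f" b j s] less.prems False
            by (simp_all add: t_def l_def)
          have "(th N (2 * Suc f) ^ (p ^ Suc j)) ^ (p ^ s) \<in> T n" by (rule G_frob[OF desc(2)])
          then have "th (Suc (n + d)) (2 * Suc f) ^ (p ^ (Suc j + s)) \<in> T n"
            by (simp only: N power_mult[symmetric] power_add[symmetric])
          then have "2 ^ d * (2 * Suc f) \<le> Suc j + s" by (simp only: th_exponent_below)
          then have e1: "2 ^ Suc d * Suc f \<le> Suc j + s" by simp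
          then have "2 * (2 ^ d * Suc f) \<le> Suc j + s" by simp
          then have e2: "2 ^ d * Suc f \<le> j" using \<open>s \<le> j\<close> by linarith
          have t_j: "t ^ (p ^ j) \<in> T (Suc n)"
            using th_exponent_below[of "Suc n" d "Suc f" j] e2 by (simp add: t_def N)
          have t_q: "t ^ (p ^ Suc j) \<in> G n s"
          proof (rule small_exponent_in_G)
            show "t ^ (p ^ Suc j) \<in> T (Suc n)" by (rule frob_mono[OF T_subfield t_j]) simp
            have "t ^ (p ^ (Suc j + s)) \<in> T n"
              using th_exponent_below[of n "Suc d" "Suc f" "Suc j + s"] e1 by (simp only: t_def N add_Suc_right)
            then show "(t ^ (p ^ Suc j)) ^ (p ^ s) \<in> T n"
              by (simp only: power_mult[symmetric] power_add[symmetric])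
          qed
          define b' where "b' = b - monom l (degree b)"
          have b': "poly_over (G N f) b'"
            unfolding b'_def using less.prems(1) l
            by (intro poly_over_diff[OF G_subfield] poly_over_monom[OF G_subfield])
          have split: "poly b t = poly b' t + l * t ^ degree b"
            by (simp add: b'_def poly_monom)
          have "degree b' < degree b"
          proof -
            have "degree b' \<le> degree b"
              unfolding b'_def by (intro degree_diff_le degree_monom_le order_refl)
            moreover have "coeff b' (degree b) = 0" by (simp add: b'_def l_def)
            ultimately show ?thesis using eq_zero_or_degree_less[of b' "degree b"] False by auto
          qed
          moreover have "poly b' t ^ (p ^ Suc j) \<in> G n s"
          proof -
            have "poly b' t = poly b t - l * t ^ degree b" by (simp add: split)
            then have "poly b' t ^ (p ^ Suc j)
              = poly b t ^ (p ^ Suc j) - l ^ (p ^ Suc j) * (t ^ (p ^ Suc j)) ^ degree b"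
              by (simp only: frob_diff power_mult_distrib power_mult[symmetric] mult.commute)
            then show ?thesis
              using less.prems(3) desc(1) t_q sf_diff[OF G_subfield] sf_mult[OF G_subfield]
                sf_power[OF G_subfield] by metis
          qed
          ultimately have "poly b' t ^ (p ^ j) \<in> T (Suc n)"
            using less.hyps[of b'] b' less.prems(2) by simp
          moreover have "l ^ (p ^ j) \<in> T (Suc n)" using IHf[OF l desc(1)] .
          ultimately have "poly b' t ^ (p ^ j) + l ^ (p ^ j) * (t ^ (p ^ j)) ^ degree b \<in> T (Suc n)"
            by (rule sf_add[OF T_subfield _ sf_mult[OF T_subfield _ sf_power[OF T_subfield t_j]]])
          moreover have "poly b t ^ (p ^ j) = poly b' t ^ (p ^ j) + l ^ (p ^ j) * (t ^ (p ^ j)) ^ degree b"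
            by (simp only: split frob_add power_mult_distrib power_mult[symmetric] mult.commute)
          ultimately show ?thesis by simp
        qed
      qed
      then show ?case by (simp add: b(3))
    qed
  qed
qed

end

section \<open>Intermediate fields of the tower\<close>

context construction
begin

lemma T_pinsep:
  assumes "w \<in> T N"
  shows "\<exists>M. w ^ (p ^ M) \<in> T n"
proof -
  have "T N \<subseteq> pinsep (T 0)"
  proof (induction N)
    case (Suc N)
    have P: "subfield (pinsep (T 0)) amb" by (intro pinsep_subfield T_subfield)
    have "th (Suc N) i \<in> pinsep (T 0)" for i
      using th_exponent_below[of 0 N i "2 ^ N * i"] unfolding pinsep_def by auto
    then have "G N i \<subseteq> pinsep (T 0)" for i
      unfolding G_def using Suc by (intro adjoin_least[OF P]) auto
    then show ?case unfolding T_Suc by blast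
  qed (rule pinsep_incl)
  then show ?thesis using assms T_mono[of 0 n] unfolding pinsep_def by blast
qed

text \<open>Let \<open>s + 1\<close> be the first index with \<open>\<theta>(n + 1, s + 1) \<notin> L\<close>.  An element of \<open>L \<inter> K\<^sub>n\<^sub>+\<^sub>1\<close> of exponent
  above \<open>s\<close> over \<open>K\<^sub>n\<close> would generate \<open>\<theta>(n + 1, s + 1)\<close>, so \<open>L \<inter> K\<^sub>n\<^sub>+\<^sub>1 \<subseteq> G n s\<close>.  The descent then
  excludes exponents above \<open>s\<close> over \<open>K\<^sub>n\<^sub>+\<^sub>1\<close>.\<close>

lemma bounded_if_next_level_missing:
  assumes L: "subfield L amb" "T n \<subseteq> L" "L \<subseteq> (\<Union>N. T N)" and not_sub: "\<not> T (Suc n) \<subseteq> L"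
  shows "\<exists>e. \<forall>w\<in>L. w ^ (p ^ e) \<in> T n"
proof -
  have "\<exists>i. th (Suc n) i \<notin> L"
  proof (rule ccontr)
    assume "\<not> ?thesis"
    then have "G n i \<subseteq> L" for i
      unfolding G_def using L by (intro adjoin_least[OF L(1)]) auto
    then show False using not_sub by (auto simp: T_Suc)
  qed
  define i where "i = (LEAST i. th (Suc n) i \<notin> L)"
  have "th (Suc n) i \<notin> L" unfolding i_def by (rule LeastI_ex) fact
  then obtain s where s: "i = Suc s" using sf_zero[OF L(1)] by (cases i) auto
  have s_notin: "th (Suc n) (Suc s) \<notin> L" using \<open>th (Suc n) i \<notin> L\<close> s by simp
  have L_T: "w \<in> G n s" if w: "w \<in> L" "w \<in> T (Suc n)" for w
  proof -
    have "w ^ (p ^ s) \<in> T n"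
    proof (rule ccontr)
      assume not_in: "w ^ (p ^ s) \<notin> T n"
      obtain m where m: "w \<in> G n m" using w(2) by (auto simp: T_Suc)
      define m' where "m' = max m (Suc s)"
      have "th (Suc n) (Suc s) \<in> adjoin (T n) {w}"
      proof (rule simple_ext_exponent_order[OF T_subfield, where z = "th (Suc n) m'" and M = m'])
        show "w \<in> adjoin (T n) {th (Suc n) m'}"
          using m G_mono[of m m' n] by (auto simp: m'_def G_def)
        show "th (Suc n) (Suc s) \<in> adjoin (T n) {th (Suc n) m'}"
          using th_in_G G_mono[of "Suc s" m' n] by (auto simp: m'_def G_def)
        show "th (Suc n) (Suc s) ^ (p ^ Suc s) \<in> T n" "th (Suc n) m' ^ (p ^ m') \<in> T n"
          by (simp_all only: th_exponent)
        show "Suc s = 0 \<or> w ^ (p ^ (Suc s - 1)) \<notin> T n" using not_in by simp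
      qed
      also have "adjoin (T n) {w} \<subseteq> L" using w(1) L by (intro adjoin_least) auto
      finally show False using s_notin by simp
    qed
    then show ?thesis by (rule small_exponent_in_G[OF w(2)])
  qed
  have "w ^ (p ^ (s + s)) \<in> T n" if w: "w \<in> L" for w
  proof -
    obtain N where N: "w \<in> T N" using w L(3) by blast
    have "w ^ (p ^ s) \<in> T (Suc n)"
    proof (rule ccontr)
      assume "w ^ (p ^ s) \<notin> T (Suc n)"
      moreover obtain M where "w ^ (p ^ M) \<in> T (Suc n)" using T_pinsep[OF N] by blast
      ultimately obtain r where r: "r \<ge> s" "w ^ (p ^ r) \<notin> T (Suc n)" "w ^ (p ^ Suc r) \<in> T (Suc n)"
        using exists_frob_jump[OF T_subfield] by blast
      have "w ^ (p ^ Suc r) \<in> G n s" using sf_power[OF L(1) w] r(3) by (rule L_T)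
      then show False using exponent_descent[OF r(1) N] r(2) by blast
    qed
    then have "w ^ (p ^ s) \<in> G n s" using sf_power[OF L(1) w] by (intro L_T)
    then have "(w ^ (p ^ s)) ^ (p ^ s) \<in> T n" by (rule G_frob)
    then show ?thesis by (simp only: power_add power_mult)
  qed
  then show ?thesis by blast
qed

lemma bounded_level:
  assumes "w \<in> T N" "w ^ (p ^ e) \<in> T n"
  shows "w \<in> T (n + e)"
  using assms
proof (induction e arbitrary: w)
  case (Suc e)
  have "(w ^ p) ^ (p ^ e) \<in> T n" using Suc.prems(2) by (simp only: frob_Suc)
  then have "w ^ (p ^ Suc 0) \<in> G (n + e) 0"
    using Suc.IH[OF sf_power[OF T_subfield Suc.prems(1)]] by (simp add: G_0)
  then show ?case using exponent_descent[of 0 0 w N "n + e"] Suc.prems(1) by simp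
qed simp

text \<open>Over \<open>K\<^sub>n\<^sub>+\<^sub>1\<close> finitely many elements \<open>S\<close> suffice by induction.  Over \<open>F = K\<^sub>n(S)\<close>, which has some
  exponent \<open>r\<close>, the elements in question lie in the union of the simple extensions
  \<open>F(\<theta>(n + 1, i))\<close>.  As \<open>\<theta>(n + 1, e + r)\<close> still has exponent at least \<open>e\<close> over \<open>F\<close>, adjoining it
  to \<open>S\<close> captures every element of exponent at most \<open>e\<close>.\<close>

lemma bounded_part_finite:
  "\<exists>S. finite S \<and> S \<subseteq> T (n + d) \<and> {w \<in> T (n + d). w ^ (p ^ e) \<in> T n} \<subseteq> adjoin (T n) S"
proof (induction d arbitrary: n)
  case 0
  have "T n \<subseteq> adjoin (T n) {}" by (auto intro: fld_incl)
  then show ?case by (intro exI[of _ "{}"]) auto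
next
  case (Suc d)
  obtain S where S: "finite S" "S \<subseteq> T (Suc n + d)"
      "{w \<in> T (Suc n + d). w ^ (p ^ e) \<in> T (Suc n)} \<subseteq> adjoin (T (Suc n)) S"
    using Suc.IH by blast
  have "\<exists>r. \<forall>s\<in>S. s ^ (p ^ r) \<in> T n"
    using S(1,2)
  proof induction
    case (insert s S)
    then obtain r where r: "\<forall>s\<in>S. s ^ (p ^ r) \<in> T n" by auto
    obtain M where "s ^ (p ^ M) \<in> T n" using T_pinsep insert.prems by blast
    then have "\<forall>s\<in>insert s S. s ^ (p ^ max r M) \<in> T n"
      using r frob_mono[OF T_subfield] by (metis insert_iff max.cobounded1 max.cobounded2)
    then show ?case by blast
  qed simp
  then obtain r where r: "\<And>s. s \<in> S \<Longrightarrow> s ^ (p ^ r) \<in> T n" by blast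
  define F where "F = adjoin (T n) S"
  have F: "subfield F amb" unfolding F_def by (rule fld_subfield)
  have TF: "T n \<subseteq> F" unfolding F_def by (auto intro: fld_incl)
  have F_frob: "u ^ (p ^ r) \<in> T n" if "u \<in> F" for u
    by (rule frob_fld[OF _ T_subfield that[unfolded F_def]]) (use r sf_power[OF T_subfield] in auto)
  define t where "t = th (Suc n) (e + r)"
  have mem: "w \<in> adjoin F {t}" if w: "w \<in> T (n + Suc d)" "w ^ (p ^ e) \<in> T n" for w
  proof -
    have "w \<in> adjoin (T (Suc n)) S" using S(3) w T_mono[of n "Suc n"] by auto
    also have "\<dots> \<subseteq> (\<Union>i. adjoin (G n i) S)"
    proof (rule adjoin_least)
      show "subfield (\<Union>i. adjoin (G n i) S) amb"
      proof (rule subfield_UN_chain)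
        show "adjoin (G n i) S \<subseteq> adjoin (G n j) S" if "i \<le> j" for i j
          using G_mono[OF that] by (intro fld_mono) auto
      qed (simp_all add: fld_subfield)
      show "T (Suc n) \<subseteq> (\<Union>i. adjoin (G n i) S)" unfolding T_Suc by (auto intro: fld_incl)
      show "S \<subseteq> (\<Union>i. adjoin (G n i) S)" by (auto intro: fld_incl)
    qed
    finally obtain i where "w \<in> adjoin (G n i) S" by blast
    define m where "m = max i (e + r)"
    have Fm: "subfield (adjoin F {th (Suc n) m}) amb" by (rule fld_subfield)
    have FFm: "F \<subseteq> adjoin F {th (Suc n) m}" by (auto intro: fld_incl)
    have G_Fm: "G n m \<subseteq> adjoin F {th (Suc n) m}"
      unfolding G_def using TF by (intro fld_mono) auto
    have "adjoin (G n i) S \<subseteq> adjoin F {th (Suc n) m}"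
    proof (rule adjoin_least[OF Fm])
      show "G n i \<subseteq> adjoin F {th (Suc n) m}" using G_mono[of i m n] G_Fm by (auto simp: m_def)
      show "S \<subseteq> adjoin F {th (Suc n) m}" using FFm by (auto simp: F_def intro: fld_incl)
    qed
    then have wm: "w \<in> adjoin F {th (Suc n) m}" using \<open>w \<in> adjoin (G n i) S\<close> by blast
    have tm: "t \<in> adjoin F {th (Suc n) m}"
      using th_in_G[of n "e + r"] G_mono[of "e + r" m n] G_Fm by (auto simp: t_def m_def)
    have te: "e = 0 \<or> t ^ (p ^ (e - 1)) \<notin> F"
    proof (rule ccontr)
      assume "\<not> ?thesis"
      then have "e > 0" "t ^ (p ^ (e - 1)) \<in> F" by auto
      then have "(t ^ (p ^ (e - 1))) ^ (p ^ r) \<in> T n" by (intro F_frob)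
      then have "t ^ (p ^ (e - 1 + r)) \<in> T n" by (simp only: power_add power_mult)
      then have "e + r \<le> e - 1 + r" by (simp only: t_def th_exponent)
      then show False using \<open>e > 0\<close> by simp
    qed
    have "th (Suc n) m ^ (p ^ m) \<in> F" using TF th_exponent[of n m m] by auto
    then show ?thesis
      by (rule simple_ext_exponent_order[OF F _ tm wm _ te]) (use w(2) TF in auto)
  qed
  have "adjoin F {t} = adjoin (T n) (S \<union> {t})"
    unfolding F_def by (simp only: fld_Un_fld Un_assoc)
  then have "{w \<in> T (n + Suc d). w ^ (p ^ e) \<in> T n} \<subseteq> adjoin (T n) (S \<union> {t})"
    using mem by blast
  moreover have "S \<union> {t} \<subseteq> T (n + Suc d)" using S(2) by (auto simp: t_def th_in_T)
  ultimately show ?case using S(1) by (intro exI[of _ "S \<union> {t}"]) auto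
qed

end

section \<open>Roots, algebraic elements and finite dimension in the ambient field\<close>

lemma amb_pow [simp]: "x [^]\<^bsub>(amb :: 'a :: field ring)\<^esub> (n :: nat) = x ^ n"
proof -
  interpret field "amb :: 'a ring" by (rule amb_field)
  show ?thesis by (induction n) (simp_all add: mult.commute)
qed

lemma power_minus_poly:
  fixes F :: "'a :: field set"
  assumes F: "subfield F amb" and c: "c \<in> F" and n: "n > 0"
  defines "P \<equiv> 1 # replicate (n - 1) 0 @ [- c]"
  shows "P \<in> carrier (univ_poly amb F)" "length P = Suc n" "ring.eval amb P y = y ^ n - c"
proof -
  interpret field "amb :: 'a ring" by (rule amb_field)
  show "P \<in> carrier (univ_poly amb F)"
    using c by (auto simp: P_def univ_poly_def polynomial_def sf_closed[OF F])
  show "length P = Suc n" using n by (simp add: P_def)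
  have "eval (replicate m 0 @ [- c]) y = - c" for m by (induction m) auto
  then show "eval P y = y ^ n - c" using n by (simp add: P_def)
qed

lemma algebraic_of_power:
  fixes F :: "'a :: field set"
  assumes F: "subfield F amb" and c: "y ^ n \<in> F" and n: "n > 0"
  shows "ring.algebraic amb F y"
proof -
  interpret field "amb :: 'a ring" by (rule amb_field)
  show ?thesis
  proof (rule algebraicI[unfolded over_def])
    let ?P = "1 # replicate (n - 1) 0 @ [- (y ^ n)]"
    show "?P \<in> carrier (univ_poly amb F)" by (rule power_minus_poly[OF F c n])
    show "eval ?P y = \<zero>\<^bsub>amb\<^esub>" by (simp only: power_minus_poly[OF F c n]) simp
  qed simp
qed

lemma root_exists_of_closure:
  assumes "algebraic_closure (amb :: 'a :: field ring) k" "n > 0"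
  shows "\<exists>r. r ^ n = (y :: 'a)"
proof -
  interpret algebraic_closure "amb :: 'a ring" k by fact
  let ?P = "1 # replicate (n - 1) 0 @ [- y]"
  have U: "subfield (UNIV :: 'a set) amb" using carrier_is_subfield by simp
  have P: "?P \<in> carrier (poly_ring amb)" "length ?P = Suc n"
    using power_minus_poly(1,2)[OF U, of y n] assms(2) by simp_all
  have "splitted ?P" by (rule roots_over_carrier[OF P(1)])
  then have "size (roots ?P) = n" using P(2) by (simp add: splitted_def)
  then obtain r where "r \<in># roots ?P" using assms(2) by (metis size_empty multiset_nonemptyE not_gr_zero)
  then have "eval ?P r = \<zero>\<^bsub>amb\<^esub>"
    using roots_mem_iff_is_root[OF P(1)] by (simp only: is_root_def)
  then have "r ^ n - y = 0" using power_minus_poly(3)[OF U, of y n r] assms(2) by simp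
  then show ?thesis by auto
qed

lemma finite_dimension_of_adjoin:
  fixes F L :: "'a :: field set"
  assumes F: "subfield F amb" and L: "subfield L amb" "F \<subseteq> L" "L \<subseteq> adjoin F S"
    and S: "finite S" "\<And>s. s \<in> S \<Longrightarrow> ring.algebraic amb F s"
  shows "ring.finite_dimension amb F L"
proof -
  interpret field "amb :: 'a ring" by (rule amb_field)
  obtain xs where xs: "set xs = S" using S(1) finite_list by blast
  let ?E = "finite_extension F xs"
  have sub: "subfield ?E amb"
    by (rule finite_extension_is_subfield[OF F]) (use S xs in \<open>auto simp: over_def\<close>)
  have "F \<subseteq> ?E" by (rule finite_extension_incl) simp_all
  moreover have "S \<subseteq> ?E"
    using finite_extension_mem[OF subfieldE(1)[OF F], of xs] xs by simp
  ultimately have "L \<subseteq> ?E" using adjoin_least[OF sub] L(3) by blast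
  moreover have "finite_dimension F ?E"
    by (rule finite_extension_finite_dimension[OF F]) (use S xs in \<open>auto simp: over_def\<close>)
  moreover have "subalgebra F L amb"
  proof (rule subalgebra.intro)
    show "subgroup L (add_monoid amb)"
      using subfieldE(1)[OF L(1)] by (rule subring.axioms(1))
    show "subalgebra_axioms F L amb"
      using L(2) sf_mult[OF L(1)] by (auto simp: subalgebra_axioms_def)
  qed
  ultimately show ?thesis using subalbegra_incl_imp_finite_dimension[OF F] by blast
qed

section \<open>Subextensions of unbounded exponent\<close>

theorem mainTheorem9:
  fixes p :: nat
    and Q k K :: "'a :: field set"
    and x :: 'a
    and Z Y :: "nat \<Rightarrow> nat \<Rightarrow> 'a"
    and a :: "nat \<Rightarrow> 'a"
    and Kn :: "nat \<Rightarrow> 'a set"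
  assumes char: "CHAR('a) = p" "p > 0"
    and Q: "subfield Q amb" "perfect_char p Q"
    and indep: "alg_independent Q indets (indet_val x Z Y)"
    and k: "k = base_field Q x Z Y"
    and closure: "algebraic_closure (amb :: 'a ring) k"
    and a_in: "\<And>n. n \<ge> 1 \<Longrightarrow> a n \<in> (\<Union>m\<in>{1..}. adjoin Q {proot p m x})"
    and a_gen: "\<And>n. n \<ge> 1 \<Longrightarrow> adjoin Q {a n} = adjoin Q {proot p n x}"
    and Kn: "Kn = tower k p a Z Y"
    and K: "K = tower_union k p a Z Y"
  shows "\<forall>L. subfield L amb \<and> k \<subseteq> L \<and> L \<subset> K \<and> \<not> bounded_exponent p k L \<longrightarrow>
           (\<exists>i\<ge>1. Kn i \<subseteq> L \<and> ring.finite_dimension amb (Kn i) L)"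
proof (intro allI impI, elim conjE)
  interpret construction p "TYPE('a)" Q x Z Y a
    by (intro construction.intro construction_axioms.intro char_p.intro char Q(1) indep a_gen
        root_exists_of_closure[OF closure])
  have KnT: "Kn n = T n" for n unfolding Kn k by (rule tower_eq)
  have kT: "k = T 0" using KnT[of 0] by (simp add: Kn)
  have KT: "K = (\<Union>N. T N)"
  proof -
    have "K = (\<Union>n\<in>{1..}. T n)" using KnT by (simp add: K tower_union_def Kn)
    moreover have "T N \<subseteq> (\<Union>n\<in>{1..}. T n)" for N using T_mono[of N "Suc N"] by auto
    ultimately show ?thesis by blast
  qed
  fix L assume L: "subfield L amb" "k \<subseteq> L" "L \<subset> K" and unbounded: "\<not> bounded_exponent p k L"
  have LU: "L \<subseteq> (\<Union>N. T N)" using L(3) KT by blast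
  have "\<exists>n. \<not> T n \<subseteq> L" using L(3) KT by blast
  define m where "m = (LEAST n. \<not> T n \<subseteq> L)"
  have m: "\<not> T m \<subseteq> L" unfolding m_def by (rule LeastI_ex) fact
  then obtain n where n: "m = Suc n" using L(2) kT by (cases m) auto
  have Tn: "T n \<subseteq> L" using not_less_Least[of n "\<lambda>n. \<not> T n \<subseteq> L"] n by (simp add: m_def)
  obtain e where e: "\<And>w. w \<in> L \<Longrightarrow> w ^ (p ^ e) \<in> T n"
    using bounded_if_next_level_missing[OF L(1) Tn LU] m n by blast
  have "n \<noteq> 0"
  proof
    assume "n = 0"
    then have "\<forall>w\<in>L. w ^ (p ^ e) \<in> k" using e kT by simp
    then show False using unbounded unfolding bounded_exponent_def by blast
  qed
  obtain S where S: "finite S" "S \<subseteq> T (n + e)" "{w \<in> T (n + e). w ^ (p ^ e) \<in> T n} \<subseteq> adjoin (T n) S"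
    using bounded_part_finite[of n e e] by (elim exE conjE)
  have "ring.finite_dimension amb (T n) L"
  proof (rule finite_dimension_of_adjoin[OF T_subfield L(1) Tn _ S(1)])
    show "L \<subseteq> adjoin (T n) S"
    proof
      fix w assume "w \<in> L"
      then obtain N where "w \<in> T N" using LU by blast
      then have "w \<in> T (n + e)" using e[OF \<open>w \<in> L\<close>] by (rule bounded_level)
      then show "w \<in> adjoin (T n) S" using S(3) e[OF \<open>w \<in> L\<close>] by blast
    qed
    fix s assume "s \<in> S"
    then obtain M where "s ^ (p ^ M) \<in> T n" using S(2) T_pinsep by blast
    then show "ring.algebraic amb (T n) s"
      by (rule algebraic_of_power[OF T_subfield]) (simp add: p_pos)
  qed
  then show "\<exists>i\<ge>1. Kn i \<subseteq> L \<and> ring.finite_dimension amb (Kn i) L"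
    using \<open>n \<noteq> 0\<close> Tn by (intro exI[of _ n]) (simp add: KnT)
qed

end
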